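(* Let $y_0=y_1\in\mathbb{R}^m$ and assume exactness. Let $\{y_k\}_{k\ge0}$ be the random iterates produced by mSDSA (stochastic dual subspace ascent with momentum). Assume $0\le\omega\le2$ and $\beta\ge0$ and that the expressions $$a_1:=1+3\beta+2\beta^2-(\omega(2-\omega)+\omega\beta)\lambda_{\min}^+,\qquad a_2:=\beta+2\beta^2+\omega\beta\lambda_{\max}$$ satisfy $a_1+a_2<1$. Let $y_*$ be any dual optimal solution, i.e. any maximizer of $D$ over $\mathbb{R}^m$, and let $q:=\frac{a_1+\sqrt{a_1^2+4a_2}}{2}$ and $\delta:=q-a_1$. Then for all $k\ge0$ $$\mathbb{E}[D(y_* )-D(y_{k+1})]\le q^k(1+\delta)\left[D(y_* )-D(y_0)\right].$$ Moreover, $a_1+a_2\le q<1$.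
   Context: Let $\mathbf{A}\in\mathbb{R}^{m\times n}$ and $b\in\mathbb{R}^m$ be such that the linear system $\mathbf{A}x=b$ is consistent, with solution set $\mathcal{L}=\{x\in\mathbb{R}^n:\mathbf{A}x=b\}$. Let $\mathbf{B}\in\mathbb{R}^{n\times n}$ be symmetric positive definite and let $x_0\in\mathbb{R}^n$ be a fixed vector. For a positive definite matrix $\mathbf{M}$ write $\|x\|_{\mathbf{M}}:=(x^\top\mathbf{M}x)^{1/2}$. Let $\mathcal{D}$ be an arbitrary probability distribution over real matrices $\mathbf{S}$ with $m$ rows. For such $\mathbf{S}$ define $$\mathbf{H}:=\mathbf{S}(\mathbf{S}^\top\mathbf{A}\mathbf{B}^{-1}\mathbf{A}^\top\mathbf{S})^\dagger\mathbf{S}^\top,\quad \mathbf{Z}:=\mathbf{A}^\top\mathbf{H}\mathbf{A},\quad f_{\mathbf{S}}(x):=\tfrac12(\mathbf{A}x-b)^\top\mathbf{H}(\mathbf{A}x-b),$$ where $\dagger$ is the Moore–Penrose pseudoinverse, and $f(x):=\mathbb{E}_{\mathbf{S}\sim\mathcal{D}}[f_{\mathbf{S}}(x)]$. Let $\mathbf{W}:=\mathbf{B}^{-1/2}\mathbb{E}[\mathbf{Z}]\mathbf{B}^{-1/2}$; $\lambda_{\max}$ is its largest eigenvalue and $\lambda_{\min}^+$ its smallest nonzero eigenvalue (it is presupposed that $\mathbf{W}\neq 0$, so that this is defined). Exactness means: the set of minimizers of $f$ equals $\mathcal{L}$. The dual objective (the dual of minimizing $\frac12\|x-x_0\|_{\mathbf{B}}^2$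 subject to $\mathbf{A}x=b$) is $$D(y):=(b-\mathbf{A}x_0)^\top y-\tfrac12\|\mathbf{A}^\top y\|_{\mathbf{B}^{-1}}^2,\qquad y\in\mathbb{R}^m.$$ mSDSA with stepsize $\omega$ and momentum parameter $\beta$: given deterministic $y_0,y_1$, for each $k\ge1$ draw a fresh independent $\mathbf{S}_k\sim\mathcal{D}$ and set $$\lambda_k=(\mathbf{S}_k^\top\mathbf{A}\mathbf{B}^{-1}\mathbf{A}^\top\mathbf{S}_k)^\dagger\mathbf{S}_k^\top\left(b-\mathbf{A}(x_0+\mathbf{B}^{-1}\mathbf{A}^\top y_k)\right),\qquad y_{k+1}=y_k+\omega\mathbf{S}_k\lambda_k+\beta(y_k-y_{k-1}).$$ *)

theory Defs
  imports
    "HOL-Probability.Probability"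
    "Jordan_Normal_Form.Gauss_Jordan_Elimination"
    "Jordan_Normal_Form.Char_Poly"
begin

(* Matrices and vectors are those of Jordan_Normal_Form (explicit dimensions), because the number
   of columns of the sketching matrices is itself random. The clashing notation of HOL-Analysis
   is switched off. *)
no_notation inner (infix \<open>\<bullet>\<close> 70)
no_notation vec_nth (infixl \<open>$\<close> 90)

definition spd_mat :: "nat \<Rightarrow> real mat \<Rightarrow> bool" where
  "spd_mat n B \<longleftrightarrow> B \<in> carrier_mat n n \<and> B\<^sup>T = B \<and>
     (\<forall>x \<in> carrier_vec n. x \<noteq> 0\<^sub>v n \<longrightarrow> 0 < x \<bullet> (B *\<^sub>v x))"

(* Meaningful only for invertible B: mat_inverse B is None otherwise. *)
definition mat_inv :: "real mat \<Rightarrow> real mat" where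
  "mat_inv B = the (mat_inverse B)"

(* The symmetric positive definite square root of a symmetric positive definite matrix. *)
definition mat_sqrt :: "real mat \<Rightarrow> real mat" where
  "mat_sqrt B = (THE R. spd_mat (dim_row B) R \<and> R * R = B)"

(* The four Penrose equations. *)
definition is_pinv :: "real mat \<Rightarrow> real mat \<Rightarrow> bool" where
  "is_pinv G X \<longleftrightarrow> X \<in> carrier_mat (dim_col G) (dim_row G) \<and>
     G * X * G = G \<and> X * G * X = X \<and> (G * X)\<^sup>T = G * X \<and> (X * G)\<^sup>T = X * G"

definition pinv :: "real mat \<Rightarrow> real mat" where
  "pinv G = (THE X. is_pinv G X)"

definition mat_norm :: "real mat \<Rightarrow> real vec \<Rightarrow> real" where
  "mat_norm G x = sqrt (x \<bullet> (G *\<^sub>v x))"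

(* The measurable space of all real matrices with m rows and any number of columns: the disjoint
   union over q of the spaces of m x q matrices, each with its Borel sigma-algebra. A distribution
   over matrices with m rows is a probability measure on this space. *)
definition sketch_space :: "nat \<Rightarrow> real mat measure" where
  "sketch_space m = sigma {S. dim_row S = m}
     ({carrier_mat m q | q. True} \<union>
      {{S \<in> carrier_mat m q. S $$ (i, j) \<in> U} | q i j U. i < m \<and> j < q \<and> U \<in> sets borel})"

definition sketch_pinv :: "real mat \<Rightarrow> real mat \<Rightarrow> real mat \<Rightarrow> real mat" where
  "sketch_pinv A B S = pinv (S\<^sup>T * A * mat_inv B * A\<^sup>T * S)"

definition sketch_H :: "real mat \<Rightarrow> real mat \<Rightarrow> real mat \<Rightarrow> real mat" where
  "sketch_H A B S = S * sketch_pinv A B S * S\<^sup>T"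

definition sketch_Z :: "real mat \<Rightarrow> real mat \<Rightarrow> real mat \<Rightarrow> real mat" where
  "sketch_Z A B S = A\<^sup>T * sketch_H A B S * A"

definition sketch_f :: "real mat \<Rightarrow> real mat \<Rightarrow> real vec \<Rightarrow> real mat \<Rightarrow> real vec \<Rightarrow> real" where
  "sketch_f A B b S x = 1 / 2 * ((A *\<^sub>v x - b) \<bullet> (sketch_H A B S *\<^sub>v (A *\<^sub>v x - b)))"

definition stoch_f ::
  "real mat measure \<Rightarrow> real mat \<Rightarrow> real mat \<Rightarrow> real vec \<Rightarrow> real vec \<Rightarrow> real" where
  "stoch_f \<D> A B b x = (\<integral>S. sketch_f A B b S x \<partial>\<D>)"

definition expected_Z :: "real mat measure \<Rightarrow> real mat \<Rightarrow> real mat \<Rightarrow> real mat" where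
  "expected_Z \<D> A B =
     Matrix.mat (dim_col A) (dim_col A) (\<lambda>(i, j). \<integral>S. sketch_Z A B S $$ (i, j) \<partial>\<D>)"

definition W_mat :: "real mat measure \<Rightarrow> real mat \<Rightarrow> real mat \<Rightarrow> real mat" where
  "W_mat \<D> A B = mat_sqrt (mat_inv B) * expected_Z \<D> A B * mat_sqrt (mat_inv B)"

definition lambda_max :: "real mat \<Rightarrow> real" where
  "lambda_max W = Max {l. eigenvalue W l}"

definition lambda_min_pos :: "real mat \<Rightarrow> real" where
  "lambda_min_pos W = Min {l. eigenvalue W l \<and> l \<noteq> 0}"

definition solution_set :: "real mat \<Rightarrow> real vec \<Rightarrow> real vec set" where
  "solution_set A b = {x \<in> carrier_vec (dim_col A). A *\<^sub>v x = b}"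

definition minimizers :: "nat \<Rightarrow> (real vec \<Rightarrow> real) \<Rightarrow> real vec set" where
  "minimizers n f = {x \<in> carrier_vec n. \<forall>z \<in> carrier_vec n. f x \<le> f z}"

definition exactness :: "real mat measure \<Rightarrow> real mat \<Rightarrow> real mat \<Rightarrow> real vec \<Rightarrow> bool" where
  "exactness \<D> A B b \<longleftrightarrow> minimizers (dim_col A) (stoch_f \<D> A B b) = solution_set A b"

definition dual_obj :: "real mat \<Rightarrow> real mat \<Rightarrow> real vec \<Rightarrow> real vec \<Rightarrow> real vec \<Rightarrow> real" where
  "dual_obj A B b x0 y = (b - A *\<^sub>v x0) \<bullet> y - 1 / 2 * (mat_norm (mat_inv B) (A\<^sup>T *\<^sub>v y))\<^sup>2"

definition dual_lambda ::
  "real mat \<Rightarrow> real mat \<Rightarrow> real vec \<Rightarrow> real vec \<Rightarrow> real mat \<Rightarrow> real vec \<Rightarrow> real vec" where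
  "dual_lambda A B b x0 S y =
     sketch_pinv A B S *\<^sub>v (S\<^sup>T *\<^sub>v (b - A *\<^sub>v (x0 + mat_inv B *\<^sub>v (A\<^sup>T *\<^sub>v y))))"

(* The iterates for one realization S 1, S 2, ... of the sketches; S 0 is not used. *)
fun msdsa ::
  "real mat \<Rightarrow> real mat \<Rightarrow> real vec \<Rightarrow> real vec \<Rightarrow> real \<Rightarrow> real \<Rightarrow> real vec \<Rightarrow> real vec \<Rightarrow>
   (nat \<Rightarrow> real mat) \<Rightarrow> nat \<Rightarrow> real vec" where
  "msdsa A B b x0 \<omega> \<beta> y0 y1 S 0 = y0"
| "msdsa A B b x0 \<omega> \<beta> y0 y1 S (Suc 0) = y1"
| "msdsa A B b x0 \<omega> \<beta> y0 y1 S (Suc (Suc k)) =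
     (let y = msdsa A B b x0 \<omega> \<beta> y0 y1 S (Suc k);
          y' = msdsa A B b x0 \<omega> \<beta> y0 y1 S k
      in y + \<omega> \<cdot>\<^sub>v (S (Suc k) *\<^sub>v dual_lambda A B b x0 (S (Suc k)) y) + \<beta> \<cdot>\<^sub>v (y - y'))"

end

theory Submission
  imports Defs
begin

text \<open>Put \<open>R = B\<^sup>-\<^sup>1\<^sup>/\<^sup>2\<close>, \<open>L = R A\<^sup>T\<close> and measure a dual vector \<open>y\<close> by \<open>\<rho> = L (y - y\<^sub>*)\<close>. Completing the
square in the concave quadratic \<open>D\<close> shows that the dual gap is half the squared norm of
\<open>\<rho>\<close> (\<open>dual_gap\<close>), and one step of the algorithm becomes
\<open>\<rho>\<^sub>k\<^sub>+\<^sub>1 = \<rho>\<^sub>k - \<omega> P\<^sub>k \<rho>\<^sub>k + \<beta> (\<rho>\<^sub>k - \<rho>\<^sub>k\<^sub>-\<^sub>1)\<close>, where \<open>P\<^sub>k\<close> is the orthogonal projection onto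
the range of \<open>L S\<^sub>k\<close> (\<open>msdsa_momentum_iter\<close>). The mean of \<open>P\<^sub>k\<close> is exactly \<open>W\<close>, so \<open>A\<close>, \<open>B\<close> and the
pseudoinverse disappear from the problem.

For a fixed projection the identity \<open>P P = P\<close> and two elementary inequalities bound the new
squared norm by the old squared norms and the quadratic forms of \<open>P\<close> at the two preceding
iterates (\<open>momentum_step_norm\<close>). Both iterates depend only on earlier sketches, so
in expectation \<open>P\<close> may be replaced by \<open>W\<close> (\<open>expected_proj_quadratic_form\<close>). The form of \<open>W\<close> is at
most \<open>\<lambda>\<^sub>m\<^sub>a\<^sub>x\<close> times the squared norm everywhere. It is at least \<open>\<lambda>\<^sub>m\<^sub>i\<^sub>n\<^sup>+\<close> times the squared norm on
the orthogonal complement of the kernel of \<open>W\<close>, and the iterates stay there: exactness says that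
a vector killed by \<open>W\<close> is killed by \<open>L\<^sup>T\<close>, hence is orthogonal to the range of \<open>L\<close>. So
\<open>F\<^sub>k = E |\<rho>\<^sub>k|\<^sup>2\<close> satisfies \<open>F\<^sub>k\<^sub>+\<^sub>2 \<le> a\<^sub>1 F\<^sub>k\<^sub>+\<^sub>1 + a\<^sub>2 F\<^sub>k\<close> (\<open>expected_norm_recursion\<close>). The number \<open>q\<close> is
the larger root of \<open>t\<^sup>2 = a\<^sub>1 t + a\<^sub>2\<close>, and \<open>F\<^sub>k\<^sub>+\<^sub>1 + \<delta> F\<^sub>k\<close> shrinks by the factor \<open>q\<close> in each step.

Two foundations carry this. The spectral theorem for real symmetric matrices supplies square
roots, pseudoinverses and the eigenvalue bounds. Expectations require the projection to be a
measurable function of the sketch although the pseudoinverse is discontinuous; it is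
recovered entrywise as a limit of polynomials in measurable quantities (\<open>range_proj_limit\<close>).\<close>

section \<open>Matrix algebra with dimension side conditions\<close>

text \<open>The carrier-based laws have dimensions as hidden parameters in their premises, which the simplifier
cannot guess. Phrased as equations between \<open>dim_row\<close> and \<open>dim_col\<close>, the premises are solved by
rewriting.\<close>

lemma mult_assoc_dim:
  fixes X Y Z :: "'a::semiring_0 mat"
  assumes "dim_col X = dim_row Y" "dim_col Y = dim_row Z"
  shows "X * Y * Z = X * (Y * Z)"
  by (rule assoc_mult_mat[of X "dim_row X" "dim_col X" Y "dim_col Y" Z "dim_col Z"])
    (use assms in \<open>auto intro: carrier_matI\<close>)

lemma mult_vec_assoc_dim:
  fixes X Y :: "'a::semiring_0 mat"
  assumes "dim_col X = dim_row Y" "dim_col Y = dim_vec v"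
  shows "X * Y *\<^sub>v v = X *\<^sub>v (Y *\<^sub>v v)"
  by (rule assoc_mult_mat_vec[of X "dim_row X" "dim_col X" Y "dim_col Y"])
    (use assms in \<open>auto intro: carrier_matI carrier_vecI\<close>)

lemma transpose_mult_dim:
  fixes X Y :: "'a::comm_semiring_0 mat"
  assumes "dim_col X = dim_row Y"
  shows "(X * Y)\<^sup>T = Y\<^sup>T * X\<^sup>T"
  by (rule transpose_mult[of X "dim_row X" "dim_col X" Y "dim_col Y"])
    (use assms in \<open>auto intro: carrier_matI\<close>)

lemmas mat_dims = mult_assoc_dim mult_vec_assoc_dim transpose_mult_dim

lemma scalar_prod_mult_vec:
  fixes X :: "real mat"
  assumes "dim_row X = dim_vec u" "dim_col X = dim_vec v"
  shows "u \<bullet> (X *\<^sub>v v) = (X\<^sup>T *\<^sub>v u) \<bullet> v"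
proof -
  have "u \<bullet> (X *\<^sub>v v) = (\<Sum>i<dim_row X. \<Sum>j<dim_col X. u $ i * X $$ (i, j) * v $ j)"
    using assms by (simp add: scalar_prod_def sum_distrib_left atLeast0LessThan mult.assoc)
  also have "\<dots> = (\<Sum>j<dim_col X. \<Sum>i<dim_row X. u $ i * X $$ (i, j) * v $ j)"
    by (rule sum.swap)
  also have "\<dots> = (X\<^sup>T *\<^sub>v u) \<bullet> v"
    using assms by (simp add: scalar_prod_def sum_distrib_right atLeast0LessThan mult.assoc mult.left_commute)
  finally show ?thesis .
qed

lemma quadratic_form_sum:
  fixes Q :: "real mat"
  assumes "Q \<in> carrier_mat n n" "x \<in> carrier_vec n"
  shows "x \<bullet> (Q *\<^sub>v x) = (\<Sum>i<n. \<Sum>j<n. (x $ i * x $ j) * Q $$ (i, j))"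
  using carrier_matD[OF assms(1)] carrier_vecD[OF assms(2)]
  by (simp add: scalar_prod_def atLeast0LessThan sum_distrib_left ac_simps)

lemma scalar_prod_self_nonneg: "0 \<le> v \<bullet> (v :: real vec)"
  by (simp add: scalar_prod_def sum_nonneg)

lemma scalar_prod_self_eq_0:
  fixes v :: "real vec"
  assumes "v \<in> carrier_vec n"
  shows "v \<bullet> v = 0 \<longleftrightarrow> v = 0\<^sub>v n"
proof -
  have "v \<bullet> v = 0 \<longleftrightarrow> (\<forall>i<n. v $ i = 0)"
    using assms by (auto simp: scalar_prod_def sum_nonneg_eq_0_iff)
  then show ?thesis using assms by (simp add: vec_eq_iff)
qed

text \<open>The diagonal entries of \<open>E\<^sup>T E\<close> are the squared norms of the columns of \<open>E\<close>.\<close>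

lemma transpose_mult_self_eq_0:
  fixes E :: "real mat"
  assumes "E\<^sup>T * E = 0\<^sub>m (dim_col E) (dim_col E)"
  shows "E = 0\<^sub>m (dim_row E) (dim_col E)"
proof (rule eq_matI)
  fix i j assume "i < dim_row (0\<^sub>m (dim_row E) (dim_col E))" "j < dim_col (0\<^sub>m (dim_row E) (dim_col E))"
  then have ij: "i < dim_row E" "j < dim_col E" by auto
  have "(E\<^sup>T * E) $$ (j, j) = col E j \<bullet> col E j" using ij by simp
  then have "col E j \<bullet> col E j = 0" using assms ij by simp
  then have "col E j = 0\<^sub>v (dim_row E)" by (subst (asm) scalar_prod_self_eq_0[of _ "dim_row E"]) auto
  then have "col E j $ i = 0" using ij by (simp del: index_col)
  then show "E $$ (i, j) = 0\<^sub>m (dim_row E) (dim_col E) $$ (i, j)" using ij by simp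
qed auto

lemma dim_mat_diag [simp]: "dim_row (mat_diag n f) = n" "dim_col (mat_diag n f) = n"
  by (simp_all add: mat_diag_def)

section \<open>The spectral theorem for real symmetric matrices\<close>

text \<open>Compactness of the unit sphere of a subspace of \<open>n\<close>-space. Vectors of explicit
dimension carry no topology, so they are represented as real sequences vanishing from position \<open>n\<close>
on, inside the product space \<open>nat \<Rightarrow> real\<close>; there the sphere is closed in a product of compact
intervals.\<close>

lemma compact_sphere_orthogonal_to:
  fixes u :: "nat \<Rightarrow> nat \<Rightarrow> real"
  shows "compact {x :: nat \<Rightarrow> real. (\<forall>i\<ge>n. x i = 0) \<and> (\<Sum>i<n. x i * x i) = 1 \<and>
           (\<forall>k<j. (\<Sum>i<n. u k i * x i) = 0)}" (is "compact ?K")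
proof -
  define Box where "Box = PiE UNIV (\<lambda>i. if i < n then {-1..1::real} else {0})"
  have "compactin (product_topology (\<lambda>i::nat. euclidean) UNIV) Box"
    unfolding Box_def by (subst compactin_PiE) auto
  then have box: "compact Box"
    by (simp add: euclidean_product_topology)
  have cl: "closed {x :: nat \<Rightarrow> real. g x = c}" if "continuous_on UNIV g" for g and c :: real
    using that by (rule closed_Collect_eq) auto
  have "?K = Box \<inter> ((\<Inter>i\<in>{n..}. {x. x i = 0}) \<inter> {x. (\<Sum>i<n. x i * x i) = 1} \<inter>
          (\<Inter>k\<in>{..<j}. {x. (\<Sum>i<n. u k i * x i) = 0}))" (is "_ = Box \<inter> ?C")
  proof -
    have "x \<in> Box" if "x \<in> ?K" for x
    proof -
      have "\<bar>x i\<bar> \<le> 1" if "i < n" for i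
      proof -
        have "x i * x i \<le> (\<Sum>i<n. x i * x i)"
          using that by (intro member_le_sum) auto
        then have "\<bar>x i\<bar>\<^sup>2 \<le> 1\<^sup>2" using \<open>x \<in> ?K\<close> by (simp add: power2_eq_square)
        then show ?thesis by (rule power2_le_imp_le) simp
      qed
      then show ?thesis using that by (auto simp: Box_def PiE_def Pi_def abs_le_iff) 
    qed
    then show ?thesis by auto
  qed
  moreover have "closed ?C"
    by (intro closed_Int closed_INT ballI cl continuous_intros)
      (auto intro: continuous_on_product_coordinates)
  ultimately show ?thesis using box by (simp add: compact_Int_closed)
qed

text \<open>Pad the \<open>j < n\<close> given vectors with zero rows to a square matrix; a zero row makes it singular, and a
kernel vector is what is wanted.\<close>

lemma nonzero_vec_orthogonal_to_few:
  fixes u :: "nat \<Rightarrow> real vec"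
  assumes "\<And>k. k < j \<Longrightarrow> u k \<in> carrier_vec n" and "j < n"
  shows "\<exists>v \<in> carrier_vec n. v \<noteq> 0\<^sub>v n \<and> (\<forall>k<j. u k \<bullet> v = 0)"
proof -
  define U where "U = mat_of_rows n (map (\<lambda>k. if k < j then u k else 0\<^sub>v n) [0..<n])"
  have U: "U \<in> carrier_mat n n" by (simp add: U_def mat_of_rows_def)
  have rows: "row U k = (if k < j then u k else 0\<^sub>v n)" if "k < n" for k
    using that assms(1) by (auto simp: U_def)
  have "col U\<^sup>T (n - 1) = 0\<^sub>v n" using U rows[of "n - 1"] \<open>j < n\<close> by auto
  then have "U\<^sup>T *\<^sub>v unit_vec n (n - 1) = 0\<^sub>v n"
    using U \<open>j < n\<close> by (intro eq_vecI) (auto simp: vec_eq_iff)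
  moreover have "unit_vec n (n - 1) \<noteq> (0\<^sub>v n :: real vec)"
    using \<open>j < n\<close> by (auto simp: vec_eq_iff)
  ultimately have "det U\<^sup>T = 0"
    using U by (subst det_0_iff_vec_prod_zero_field[of _ n]) (auto intro!: exI[of _ "unit_vec n (n - 1)"])
  then have "det U = 0" using U by (simp add: det_transpose)
  then obtain v where v: "v \<in> carrier_vec n" "v \<noteq> 0\<^sub>v n" "U *\<^sub>v v = 0\<^sub>v n"
    using det_0_iff_vec_prod_zero_field[OF U] by auto
  have "u k \<bullet> v = 0" if "k < j" for k
  proof -
    have "(U *\<^sub>v v) $ k = row U k \<bullet> v" using U that \<open>j < n\<close> by simp
    then show ?thesis using v rows[of k] that \<open>j < n\<close> by simp
  qed
  with v show ?thesis by blast
qed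

text \<open>First-order condition at the maximizer \<open>t = 0\<close> of a quadratic polynomial. It is used for the
Rayleigh quotient below and for the optimality of \<open>y\<^sub>*\<close>.\<close>

lemma quadratic_nonpos_imp_linear_coeff_0:
  fixes p r :: real
  assumes "\<And>t. t * p + t\<^sup>2 * r \<le> 0"
  shows "p = 0"
proof (rule ccontr)
  assume "p \<noteq> 0"
  \<comment> \<open>For the test value \<open>t = s p\<close> the linear term dominates, since \<open>s |r| < 1\<close>.\<close>
  define s where "s = 1 / (\<bar>r\<bar> + 1)"
  have s: "0 < s" "s * \<bar>r\<bar> < 1" by (auto simp: s_def field_simps)
  have "s * p * p + (s * p)\<^sup>2 * r = s * p\<^sup>2 * (1 + s * r)" by (simp add: power2_eq_square algebra_simps)
  moreover have "0 < s * p\<^sup>2" using s \<open>p \<noteq> 0\<close> by simp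
  moreover have "0 < 1 + s * r"
  proof -
    have "- (s * r) \<le> s * \<bar>r\<bar>" using s by (metis abs_ge_minus_self abs_mult abs_of_pos)
    with s show ?thesis by linarith
  qed
  ultimately have "0 < s * p * p + (s * p)\<^sup>2 * r" by simp
  with assms[of "s * p"] show False by simp
qed

text \<open>Maximize the Rayleigh quotient over the unit sphere of the orthogonal complement of the eigenvectors
already found. That complement is invariant under the symmetric matrix \<open>A\<close>, so the gradient
\<open>A v - e v\<close> at a maximizer \<open>v\<close> lies in it again; being also orthogonal to every vector of the
complement, it vanishes.\<close>

lemma next_eigenvector:
  fixes A :: "real mat" and u :: "nat \<Rightarrow> real vec" and d :: "nat \<Rightarrow> real"
  assumes A: "A \<in> carrier_mat n n" "A\<^sup>T = A" and "j < n"
    and u: "\<And>k. k < j \<Longrightarrow> u k \<in> carrier_vec n" and Au: "\<And>k. k < j \<Longrightarrow> A *\<^sub>v u k = d k \<cdot>\<^sub>v u k"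
  shows "\<exists>v e. v \<in> carrier_vec n \<and> v \<bullet> v = 1 \<and> (\<forall>k<j. u k \<bullet> v = 0) \<and> A *\<^sub>v v = e \<cdot>\<^sub>v v"
proof -
  define K where "K = {x :: nat \<Rightarrow> real. (\<forall>i\<ge>n. x i = 0) \<and> (\<Sum>i<n. x i * x i) = 1 \<and>
           (\<forall>k<j. (\<Sum>i<n. u k $ i * x i) = 0)}"
  define V where "V = {v \<in> carrier_vec n. \<forall>k<j. u k \<bullet> v = 0}"
  define f where "f x = (\<Sum>i<n. \<Sum>l<n. x i * A $$ (i, l) * x l)" for x :: "nat \<Rightarrow> real"
  have Kvec: "vec n x \<in> V" "vec n x \<bullet> vec n x = 1" if "x \<in> K" for x
    using that u by (auto simp: K_def V_def scalar_prod_def atLeast0LessThan)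
  have vecK: "(\<lambda>i. if i < n then v $ i else 0) \<in> K" if "v \<in> V" "v \<bullet> v = 1" for v
    using that u by (auto simp: K_def V_def scalar_prod_def atLeast0LessThan)
  have f: "f x = vec n x \<bullet> (A *\<^sub>v vec n x)" for x
    using A by (simp add: f_def scalar_prod_def atLeast0LessThan sum_distrib_left mult.assoc)
  have f': "f (\<lambda>i. if i < n then v $ i else 0) = v \<bullet> (A *\<^sub>v v)" if "v \<in> V" for v
  proof -
    have "vec n (\<lambda>i. if i < n then v $ i else 0) = v" using that by (auto simp: V_def)
    then show ?thesis by (simp add: f)
  qed
  have smult_V: "c \<cdot>\<^sub>v v \<in> V" if "v \<in> V" for c v using that u by (auto simp: V_def)
  have "compact K" unfolding K_def by (rule compact_sphere_orthogonal_to)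
  moreover have "continuous_on K f"
    unfolding f_def by (intro continuous_intros continuous_on_subset[OF continuous_on_product_coordinates]) auto
  moreover have "K \<noteq> {}"
  proof -
    obtain v where v: "v \<in> V" "v \<noteq> 0\<^sub>v n"
      using nonzero_vec_orthogonal_to_few[of j u n] u \<open>j < n\<close> unfolding V_def by blast
    then have pos: "0 < v \<bullet> v"
      using scalar_prod_self_nonneg[of v] scalar_prod_self_eq_0[of v n] by (auto simp: V_def less_le)
    have vc: "v \<in> carrier_vec n" using v by (simp add: V_def)
    define w where "w = (1 / sqrt (v \<bullet> v)) \<cdot>\<^sub>v v"
    have "w \<in> V" using v smult_V by (simp add: w_def)
    moreover have "w \<bullet> w = 1"
    proof -
      have "w \<bullet> w = (1 / sqrt (v \<bullet> v)) * ((1 / sqrt (v \<bullet> v)) * (v \<bullet> v))"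
        unfolding w_def using vc by simp
      also have "\<dots> = 1" using pos by (simp add: field_simps)
      finally show ?thesis .
    qed
    ultimately show ?thesis using vecK by blast
  qed
  ultimately obtain x where x: "x \<in> K" "\<And>z. z \<in> K \<Longrightarrow> f z \<le> f x"
    using continuous_attains_sup[of K f] by blast
  define v where "v = vec n x"
  define e where "e = f x"
  have v: "v \<in> V" "v \<bullet> v = 1" and vn: "v \<in> carrier_vec n" using Kvec[OF x(1)] by (auto simp: v_def)
  have e: "e = v \<bullet> (A *\<^sub>v v)" by (simp add: e_def v_def f)
  have rayleigh: "w \<bullet> (A *\<^sub>v w) \<le> e * (w \<bullet> w)" if w: "w \<in> V" for w
  proof (cases "w \<bullet> w = 0")
    case True
    have "w \<in> carrier_vec n" using w by (simp add: V_def)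
    then have "w = 0\<^sub>v n" using True scalar_prod_self_eq_0[of w n] by auto
    then show ?thesis using A by simp
  next
    case False
    then have pos: "0 < w \<bullet> w" using scalar_prod_self_nonneg[of w] by simp
    have wn: "w \<in> carrier_vec n" using w by (simp add: V_def)
    define c where "c = 1 / sqrt (w \<bullet> w)"
    have c: "c * c * (w \<bullet> w) = 1" using pos by (simp add: c_def field_simps)
    have "c \<cdot>\<^sub>v w \<in> V" using w smult_V by simp
    moreover have "(c \<cdot>\<^sub>v w) \<bullet> (c \<cdot>\<^sub>v w) = 1" using c wn by simp
    ultimately have "(c \<cdot>\<^sub>v w) \<bullet> (A *\<^sub>v (c \<cdot>\<^sub>v w)) \<le> e"
      using x(2)[OF vecK[of "c \<cdot>\<^sub>v w"]] f'[of "c \<cdot>\<^sub>v w"] by (simp add: e_def)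
    moreover have "(c \<cdot>\<^sub>v w) \<bullet> (A *\<^sub>v (c \<cdot>\<^sub>v w)) = c * c * (w \<bullet> (A *\<^sub>v w))"
      using wn A by (simp add: mult_mat_vec[of A n n] mult.assoc)
    ultimately have "c * c * (w \<bullet> (A *\<^sub>v w)) * (w \<bullet> w) \<le> e * (w \<bullet> w)"
      using pos by (simp add: mult_right_mono)
    moreover have "c * c * (w \<bullet> (A *\<^sub>v w)) * (w \<bullet> w) = (c * c * (w \<bullet> w)) * (w \<bullet> (A *\<^sub>v w))"
      by (simp only: ac_simps)
    ultimately show ?thesis unfolding c by simp
  qed
  have crit: "w \<bullet> (A *\<^sub>v v) - e * (w \<bullet> v) = 0" if w: "w \<in> V" for w
  proof -
    have wn: "w \<in> carrier_vec n" using w by (simp add: V_def)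
    have Av: "A *\<^sub>v v \<in> carrier_vec n" "A *\<^sub>v w \<in> carrier_vec n" using A vn wn by simp_all
    have sym: "v \<bullet> (A *\<^sub>v w) = w \<bullet> (A *\<^sub>v v)"
    proof -
      have "v \<bullet> (A *\<^sub>v w) = (A *\<^sub>v v) \<bullet> w"
        using scalar_prod_mult_vec[of A v w] A vn wn by simp
      then show ?thesis using Av wn by (simp add: comm_scalar_prod[of _ n])
    qed
    have "t * (2 * (w \<bullet> (A *\<^sub>v v) - e * (w \<bullet> v))) + t\<^sup>2 * (w \<bullet> (A *\<^sub>v w) - e * (w \<bullet> w)) \<le> 0" for t
    proof -
      have "v + t \<cdot>\<^sub>v w \<in> V"
        using v w u by (auto simp: V_def scalar_prod_add_distrib[of _ n])
      from rayleigh[OF this]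
      have "(v + t \<cdot>\<^sub>v w) \<bullet> (A *\<^sub>v (v + t \<cdot>\<^sub>v w)) \<le> e * ((v + t \<cdot>\<^sub>v w) \<bullet> (v + t \<cdot>\<^sub>v w))" .
      moreover have "(v + t \<cdot>\<^sub>v w) \<bullet> (A *\<^sub>v (v + t \<cdot>\<^sub>v w)) =
         e + 2 * t * (w \<bullet> (A *\<^sub>v v)) + t\<^sup>2 * (w \<bullet> (A *\<^sub>v w))"
        using vn wn A Av sym
        by (simp add: mult_add_distrib_mat_vec[of A n n] mult_mat_vec[of A n n] scalar_prod_add_distrib[of _ n]
            add_scalar_prod_distrib[of _ n] e power2_eq_square algebra_simps)
      moreover have "(v + t \<cdot>\<^sub>v w) \<bullet> (v + t \<cdot>\<^sub>v w) = 1 + 2 * t * (w \<bullet> v) + t\<^sup>2 * (w \<bullet> w)"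
        using vn wn v(2) comm_scalar_prod[OF vn wn]
        by (simp add: scalar_prod_add_distrib[of _ n] add_scalar_prod_distrib[of _ n] power2_eq_square algebra_simps)
      ultimately show ?thesis by (simp add: algebra_simps)
    qed
    from quadratic_nonpos_imp_linear_coeff_0[OF this] show ?thesis by simp
  qed
  define g where "g = A *\<^sub>v v - e \<cdot>\<^sub>v v"
  have Avn: "A *\<^sub>v v \<in> carrier_vec n" using A vn by simp
  have g: "g \<in> carrier_vec n" using A vn by (simp add: g_def)
  have "u k \<bullet> g = 0" if k: "k < j" for k
  proof -
    have "u k \<bullet> (A *\<^sub>v v) = (A *\<^sub>v u k) \<bullet> v"
      using scalar_prod_mult_vec[of A "u k" v] A vn u[OF k] by simp
    also have "\<dots> = 0" using Au[OF k] u[OF k] vn v k by (simp add: V_def)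
    finally show ?thesis
      using v k u[OF k] Avn vn by (simp add: g_def scalar_prod_minus_distrib[of _ n] V_def)
  qed
  then have "g \<in> V" using g by (simp add: V_def)
  from crit[OF this] have "g \<bullet> g = 0"
    using g Avn vn by (simp add: g_def scalar_prod_minus_distrib[of _ n])
  then have "g = 0\<^sub>v n" using g scalar_prod_self_eq_0[of g n] by auto
  then have "A *\<^sub>v v = e \<cdot>\<^sub>v v"
    using carrier_vecD[OF Avn] carrier_vecD[OF vn] by (simp add: g_def vec_eq_iff)
  with v vn show ?thesis unfolding V_def by blast
qed

lemma orthonormal_eigenvectors:
  fixes A :: "real mat"
  assumes A: "A \<in> carrier_mat n n" "A\<^sup>T = A"
  shows "j \<le> n \<Longrightarrow> \<exists>u d. (\<forall>k<j. u k \<in> carrier_vec n \<and> A *\<^sub>v u k = d k \<cdot>\<^sub>v u k) \<and>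
     (\<forall>k<j. \<forall>l<j. u k \<bullet> u l = (if k = l then 1 else 0))"
proof (induction j)
  case (Suc j)
  then obtain u d where ud: "\<forall>k<j. u k \<in> carrier_vec n \<and> A *\<^sub>v u k = d k \<cdot>\<^sub>v u k"
    "\<forall>k<j. \<forall>l<j. u k \<bullet> u l = (if k = l then 1 else 0)" by auto
  then obtain v e where v: "v \<in> carrier_vec n" "v \<bullet> v = 1" "\<forall>k<j. u k \<bullet> v = 0" "A *\<^sub>v v = e \<cdot>\<^sub>v v"
    using next_eigenvector[OF A, of j u d] Suc.prems by auto
  have "v \<bullet> u k = 0" if "k < j" for k
    using comm_scalar_prod[OF v(1), of "u k"] ud v that by auto
  with ud v show ?case
    by (intro exI[of _ "u(j := v)"] exI[of _ "d(j := e)"]) (auto simp: less_Suc_eq)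
qed auto

definition orthonormal_mat :: "nat \<Rightarrow> real mat \<Rightarrow> bool" where
  "orthonormal_mat n Q \<longleftrightarrow> Q \<in> carrier_mat n n \<and> Q\<^sup>T * Q = 1\<^sub>m n \<and> Q * Q\<^sup>T = 1\<^sub>m n"

text \<open>The matrix with eigenvalues \<open>f 0, \<dots>, f (n - 1)\<close> in the eigenbasis formed by the columns of \<open>Q\<close>.
With \<open>Q\<close> fixed these matrices multiply pointwise, which provides the functional calculus of a
symmetric matrix.\<close>

definition spectral_mat :: "nat \<Rightarrow> real mat \<Rightarrow> (nat \<Rightarrow> real) \<Rightarrow> real mat" where
  "spectral_mat n Q f = Q * mat_diag n f * Q\<^sup>T"

theorem spectral_theorem:
  assumes A: "A \<in> carrier_mat n n" "A\<^sup>T = A"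
  obtains Q d where "orthonormal_mat n Q" "A = spectral_mat n Q d"
proof -
  obtain u d where u: "\<And>k. k < n \<Longrightarrow> u k \<in> carrier_vec n" "\<And>k. k < n \<Longrightarrow> A *\<^sub>v u k = d k \<cdot>\<^sub>v u k"
    and on: "\<And>k l. k < n \<Longrightarrow> l < n \<Longrightarrow> u k \<bullet> u l = (if k = l then 1 else 0)"
    using orthonormal_eigenvectors[OF A, of n] by blast
  define Q where "Q = mat_of_cols n (map u [0..<n])"
  have Q: "Q \<in> carrier_mat n n" by (simp add: Q_def mat_of_cols_def)
  have col: "col Q k = u k" if "k < n" for k using that u by (simp add: Q_def)
  have QTQ: "Q\<^sup>T * Q = 1\<^sub>m n"
    using Q by (intro eq_matI) (auto simp: col on)
  then have QQT: "Q * Q\<^sup>T = 1\<^sub>m n"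
    using mat_mult_left_right_inverse[of "Q\<^sup>T" n Q] Q by auto
  have "A * Q = Q * mat_diag n d"
  proof -
    have "(A * Q) $$ (i, k) = (Q * mat_diag n d) $$ (i, k)" if "i < n" "k < n" for i k
    proof -
      have "(A * Q) $$ (i, k) = (A *\<^sub>v u k) $ i" using that A Q by (simp add: col)
      also have "\<dots> = d k * col Q k $ i" using that(1) u(2)[OF that(2)] carrier_vecD[OF u(1)[OF that(2)]] col[OF that(2)] by simp
      also have "\<dots> = (Q * mat_diag n d) $$ (i, k)"
        using that Q by (simp add: mat_diag_mult_right[of _ n])
      finally show ?thesis .
    qed
    then show ?thesis using A Q by (intro eq_matI) (auto simp del: index_mult_mat(1))
  qed
  then have "A * (Q * Q\<^sup>T) = Q * mat_diag n d * Q\<^sup>T"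
    using A Q mult_assoc_dim[of A Q "Q\<^sup>T"] by simp
  then have "A = spectral_mat n Q d" using A by (simp add: QQT spectral_mat_def)
  then show ?thesis using that Q QTQ QQT by (auto simp: orthonormal_mat_def)
qed

section \<open>Functional calculus\<close>

lemma spectral_mat_carrier [simp]:
  "orthonormal_mat n Q \<Longrightarrow> spectral_mat n Q f \<in> carrier_mat n n"
  by (auto simp: spectral_mat_def orthonormal_mat_def)

lemma spectral_mat_index:
  assumes "orthonormal_mat n Q" "i < n" "j < n"
  shows "spectral_mat n Q f $$ (i, j) = (\<Sum>k<n. Q $$ (i, k) * f k * Q $$ (j, k))"
  using assms
  by (auto simp: spectral_mat_def orthonormal_mat_def mat_diag_mult_right[of _ n] scalar_prod_def atLeast0LessThan)

lemma spectral_mat_transpose: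
  "orthonormal_mat n Q \<Longrightarrow> (spectral_mat n Q f)\<^sup>T = spectral_mat n Q f"
  by (intro eq_matI) (auto simp: spectral_mat_index carrier_matD[OF spectral_mat_carrier] ac_simps)

lemma spectral_mat_mult:
  assumes Q: "orthonormal_mat n Q"
  shows "spectral_mat n Q f * spectral_mat n Q g = spectral_mat n Q (\<lambda>i. f i * g i)"
proof -
  have dims: "dim_row Q = n" "dim_col Q = n" using Q by (auto simp: orthonormal_mat_def)
  have "spectral_mat n Q f * spectral_mat n Q g
      = Q * (mat_diag n f * ((Q\<^sup>T * Q) * (mat_diag n g * Q\<^sup>T)))"
    using dims by (simp add: spectral_mat_def mult_assoc_dim)
  also have "(Q\<^sup>T * Q) * (mat_diag n g * Q\<^sup>T) = mat_diag n g * Q\<^sup>T"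
    using Q dims by (simp add: orthonormal_mat_def)
  also have "mat_diag n f * (mat_diag n g * Q\<^sup>T) = mat_diag n (\<lambda>i. f i * g i) * Q\<^sup>T"
    using dims by (simp flip: mult_assoc_dim)
  finally show ?thesis using dims by (simp add: spectral_mat_def mult_assoc_dim)
qed

lemma spectral_mat_one: "orthonormal_mat n Q \<Longrightarrow> spectral_mat n Q (\<lambda>i. 1) = 1\<^sub>m n"
  by (auto simp: spectral_mat_def orthonormal_mat_def)

lemma spectral_mat_quadratic_form:
  assumes Q: "orthonormal_mat n Q" and x: "x \<in> carrier_vec n"
  shows "x \<bullet> (spectral_mat n Q f *\<^sub>v x) = (\<Sum>k<n. f k * (col Q k \<bullet> x)\<^sup>2)"
proof -
  have "x \<bullet> (spectral_mat n Q f *\<^sub>v x)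
      = (\<Sum>i<n. \<Sum>j<n. \<Sum>k<n. f k * (Q $$ (i, k) * x $ i) * (Q $$ (j, k) * x $ j))"
    using Q x carrier_matD[OF spectral_mat_carrier[OF Q]]
    by (simp add: scalar_prod_def atLeast0LessThan spectral_mat_index sum_distrib_left sum_distrib_right ac_simps)
  also have "\<dots> = (\<Sum>k<n. \<Sum>i<n. \<Sum>j<n. f k * (Q $$ (i, k) * x $ i) * (Q $$ (j, k) * x $ j))"
    by (subst (2) sum.swap, subst sum.swap) (rule refl)
  also have "\<dots> = (\<Sum>k<n. f k * (col Q k \<bullet> x)\<^sup>2)"
    using x carrier_matD[of Q n n] Q[unfolded orthonormal_mat_def]
    by (simp add: scalar_prod_def atLeast0LessThan power2_eq_square sum_product
        sum_distrib_left ac_simps)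
  finally show ?thesis .
qed

lemma orthonormal_mat_parseval:
  assumes "orthonormal_mat n Q" "x \<in> carrier_vec n"
  shows "x \<bullet> x = (\<Sum>k<n. (col Q k \<bullet> x)\<^sup>2)"
  using spectral_mat_quadratic_form[OF assms, of "\<lambda>i. 1"] assms by (simp add: spectral_mat_one)

lemma orthonormal_mat_col:
  assumes "orthonormal_mat n Q" "k < n"
  shows "col Q k \<in> carrier_vec n" "col Q k \<bullet> col Q k = 1" "col Q k \<noteq> 0\<^sub>v n"
proof -
  have Q: "Q \<in> carrier_mat n n" "Q\<^sup>T * Q = 1\<^sub>m n" using assms by (auto simp: orthonormal_mat_def)
  show 1: "col Q k \<in> carrier_vec n" using Q by auto
  have "(Q\<^sup>T * Q) $$ (k, k) = 1" unfolding Q using assms(2) by simp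
  moreover have "(Q\<^sup>T * Q) $$ (k, k) = col Q k \<bullet> col Q k" using Q(1) assms(2) by simp
  ultimately show 2: "col Q k \<bullet> col Q k = 1" by simp
  with 1 show "col Q k \<noteq> 0\<^sub>v n" by auto
qed

lemma spectral_mat_eigenvector:
  assumes "orthonormal_mat n Q" "k < n"
  shows "spectral_mat n Q f *\<^sub>v col Q k = f k \<cdot>\<^sub>v col Q k"
proof -
  have Q: "Q \<in> carrier_mat n n" "Q\<^sup>T * Q = 1\<^sub>m n" using assms by (auto simp: orthonormal_mat_def)
  have "spectral_mat n Q f * Q = Q * mat_diag n f * (Q\<^sup>T * Q)"
    using Q(1) by (simp add: spectral_mat_def mult_assoc_dim)
  then have "spectral_mat n Q f * Q = Q * mat_diag n f" using Q by simp
  then have "col (spectral_mat n Q f * Q) k = col (Q * mat_diag n f) k" by simp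
  moreover have "col (spectral_mat n Q f * Q) k = spectral_mat n Q f *\<^sub>v col Q k"
    using Q assms carrier_matD[OF spectral_mat_carrier[OF assms(1)]] by (intro eq_vecI) auto
  moreover have "col (Q * mat_diag n f) k = f k \<cdot>\<^sub>v col Q k"
    using Q assms by (intro eq_vecI) (auto simp: mat_diag_mult_right[of _ n])
  ultimately show ?thesis by simp
qed

section \<open>Square roots and inverses of positive definite matrices\<close>

lemma spd_mat_spectral:
  assumes "orthonormal_mat n Q"
  shows "spd_mat n (spectral_mat n Q d) \<longleftrightarrow> (\<forall>k<n. 0 < d k)"
proof safe
  fix k assume "spd_mat n (spectral_mat n Q d)" "k < n"
  then have "0 < col Q k \<bullet> (spectral_mat n Q d *\<^sub>v col Q k)"
    using orthonormal_mat_col[OF assms, of k] by (auto simp: spd_mat_def)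
  then show "0 < d k"
    using orthonormal_mat_col[OF assms \<open>k < n\<close>] by (simp add: spectral_mat_eigenvector[OF assms \<open>k < n\<close>])
next
  assume d: "\<forall>k<n. 0 < d k"
  have "0 < x \<bullet> (spectral_mat n Q d *\<^sub>v x)" if x: "x \<in> carrier_vec n" "x \<noteq> 0\<^sub>v n" for x
  proof -
    have nn: "\<forall>k<n. 0 \<le> d k * (col Q k \<bullet> x)\<^sup>2" using d by (simp add: less_imp_le)
    have "(\<Sum>k<n. (col Q k \<bullet> x)\<^sup>2) \<noteq> 0"
      using orthonormal_mat_parseval[OF assms x(1)] scalar_prod_self_eq_0[OF x(1)] x by simp
    then obtain k where "k < n" "(col Q k \<bullet> x)\<^sup>2 \<noteq> 0" by (meson lessThan_iff sum.neutral)
    then have "0 < (\<Sum>k<n. d k * (col Q k \<bullet> x)\<^sup>2)"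
      using d nn by (intro sum_pos2[of _ k]) auto
    then show ?thesis using spectral_mat_quadratic_form[OF assms x(1)] by simp
  qed
  then show "spd_mat n (spectral_mat n Q d)"
    using assms by (simp add: spd_mat_def spectral_mat_transpose)
qed

lemma spd_sqrt_exists:
  assumes "spd_mat n G"
  shows "\<exists>R. spd_mat n R \<and> R * R = G"
proof -
  obtain Q d where Q: "orthonormal_mat n Q" and G: "G = spectral_mat n Q d"
    using spectral_theorem[of G n] assms by (auto simp: spd_mat_def)
  have d: "\<forall>k<n. 0 < d k" using assms spd_mat_spectral[OF Q] G by simp
  have "spectral_mat n Q (\<lambda>i. sqrt (d i)) * spectral_mat n Q (\<lambda>i. sqrt (d i)) = G"
  proof (rule eq_matI)
    fix i j assume "i < dim_row G" "j < dim_col G"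
    then have "i < n" "j < n" using Q G by (auto simp: carrier_matD[OF spectral_mat_carrier])
    then show "(spectral_mat n Q (\<lambda>i. sqrt (d i)) * spectral_mat n Q (\<lambda>i. sqrt (d i))) $$ (i, j) = G $$ (i, j)"
      unfolding spectral_mat_mult[OF Q] G using Q d by (simp add: spectral_mat_index less_imp_le)
  qed (use Q G in \<open>auto simp: carrier_matD[OF spectral_mat_carrier]\<close>)
  moreover have "spd_mat n (spectral_mat n Q (\<lambda>i. sqrt (d i)))"
    using d by (simp add: spd_mat_spectral[OF Q])
  ultimately show ?thesis by blast
qed

text \<open>The sum is the trace of \<open>E\<^sup>T R E\<close>.\<close>

lemma spd_sum_quadratic_forms_eq_0:
  assumes R: "spd_mat n R" and E: "E \<in> carrier_mat n n" and "(\<Sum>j<n. col E j \<bullet> (R *\<^sub>v col E j)) \<le> 0"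
  shows "E = 0\<^sub>m n n"
proof -
  have nn: "0 \<le> x \<bullet> (R *\<^sub>v x)" if "x \<in> carrier_vec n" for x
    using R that by (cases "x = 0\<^sub>v n") (auto simp: spd_mat_def less_imp_le)
  have colE: "col E j \<in> carrier_vec n" for j using E by auto
  have "col E j = 0\<^sub>v n" if "j < n" for j
  proof (rule ccontr)
    assume "col E j \<noteq> 0\<^sub>v n"
    then have "0 < col E j \<bullet> (R *\<^sub>v col E j)" using R colE by (auto simp: spd_mat_def)
    then have "0 < (\<Sum>j<n. col E j \<bullet> (R *\<^sub>v col E j))"
      using that nn[OF colE] by (intro sum_pos2[of _ j]) auto
    with assms(3) show False by simp
  qed
  then have "col E j $ i = 0" if "j < n" "i < n" for i j using that by (simp del: index_col)
  then show ?thesis using E by (intro eq_matI) auto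
qed

text \<open>For \<open>E = R - R'\<close> the equality of the squares says \<open>R E + E R' = 0\<close>. The trace of \<open>E\<close> times this
equation is \<open>tr (E R E) + tr (E R' E) = 0\<close>; both traces are sums of nonnegative quadratic
forms, so they vanish, and definiteness of \<open>R\<close> gives \<open>E = 0\<close>.\<close>

lemma spd_sqrt_unique:
  assumes R: "spd_mat n R" and R': "spd_mat n R'" and eq: "R * R = R' * R'"
  shows "R = R'"
proof -
  have c: "R \<in> carrier_mat n n" "R' \<in> carrier_mat n n" "R\<^sup>T = R" "R'\<^sup>T = R'"
    using R R' by (auto simp: spd_mat_def)
  define E where "E = R - R'"
  have E: "E \<in> carrier_mat n n" unfolding E_def by (rule minus_carrier_mat[OF c(2)])
  have ET: "E\<^sup>T = E" using c by (simp add: E_def transpose_minus[of _ n n])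
  have "R * E + E * R' = 0\<^sub>m n n"
  proof -
    have "R * E + E * R' = (R * R - R * R') + (R * R' - R' * R')"
      unfolding E_def using c by (simp add: mult_minus_distrib_mat[of _ n n] minus_mult_distrib_mat[of _ n n])
    also have "\<dots> = 0\<^sub>m n n"
      using c unfolding eq by (intro eq_matI) auto
    finally show ?thesis .
  qed
  then have z: "(R * E + E * R') $$ (i, j) = 0" if "i < n" "j < n" for i j using that by simp
  have colE: "col E j \<in> carrier_vec n" for j using E by auto
  have Rdim: "dim_row R = n" "dim_col R = n" "dim_row R' = n" "dim_col R' = n" "dim_row E = n" "dim_col E = n"
    using c E by auto
  have sE: "E $$ (i, j) = E $$ (j, i)" if "i < n" "j < n" for i j
    using that ET Rdim by (metis index_transpose_mat(1))
  have sR': "R' $$ (i, j) = R' $$ (j, i)" if "i < n" "j < n" for i j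
    using that c Rdim by (metis index_transpose_mat(1))
  have "(\<Sum>j<n. col E j \<bullet> (R *\<^sub>v col E j)) + (\<Sum>j<n. col E j \<bullet> (R' *\<^sub>v col E j))
      = (\<Sum>i<n. \<Sum>j<n. E $$ (j, i) * (R * E + E * R') $$ (j, i))"
  proof -
    have 1: "(\<Sum>j<n. col E j \<bullet> (R *\<^sub>v col E j)) = (\<Sum>i<n. \<Sum>j<n. E $$ (j, i) * (R * E) $$ (j, i))"
      using Rdim by (simp add: scalar_prod_def atLeast0LessThan)
    have "(\<Sum>j<n. col E j \<bullet> (R' *\<^sub>v col E j)) = (\<Sum>i<n. \<Sum>j<n. E $$ (j, i) * (\<Sum>k<n. R' $$ (j, k) * E $$ (k, i)))"
      using Rdim by (simp add: scalar_prod_def atLeast0LessThan)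
    also have "\<dots> = (\<Sum>i<n. \<Sum>j<n. E $$ (i, j) * (\<Sum>k<n. E $$ (i, k) * R' $$ (k, j)))"
    proof (intro sum.cong refl)
      fix i j assume "i \<in> {..<n}" "j \<in> {..<n}"
      moreover from this have "(\<Sum>k<n. R' $$ (j, k) * E $$ (k, i)) = (\<Sum>k<n. E $$ (i, k) * R' $$ (k, j))"
        by (intro sum.cong refl) (metis lessThan_iff mult.commute sE sR')
      ultimately show "E $$ (j, i) * (\<Sum>k<n. R' $$ (j, k) * E $$ (k, i))
          = E $$ (i, j) * (\<Sum>k<n. E $$ (i, k) * R' $$ (k, j))"
        using sE[of i j] by simp
    qed
    also have "\<dots> = (\<Sum>i<n. \<Sum>j<n. E $$ (i, j) * (E * R') $$ (i, j))"
      using Rdim by (simp add: scalar_prod_def atLeast0LessThan)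
    also have "\<dots> = (\<Sum>i<n. \<Sum>j<n. E $$ (j, i) * (E * R') $$ (j, i))"
      by (rule sum.swap)
    finally show ?thesis
      unfolding 1 using Rdim by (simp add: sum.distrib[symmetric] distrib_left del: index_mult_mat(1))
  qed
  also have "\<dots> = 0" by (intro sum.neutral ballI) (use z in simp)
  finally have sum0: "(\<Sum>j<n. col E j \<bullet> (R *\<^sub>v col E j)) + (\<Sum>j<n. col E j \<bullet> (R' *\<^sub>v col E j)) = 0" .
  have "0 \<le> x \<bullet> (R' *\<^sub>v x)" if "x \<in> carrier_vec n" for x
    using R' that by (cases "x = 0\<^sub>v n") (auto simp: spd_mat_def less_imp_le)
  then have "0 \<le> (\<Sum>j<n. col E j \<bullet> (R' *\<^sub>v col E j))" using colE by (intro sum_nonneg) auto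
  with sum0 have "(\<Sum>j<n. col E j \<bullet> (R *\<^sub>v col E j)) \<le> 0" by linarith
  from spd_sum_quadratic_forms_eq_0[OF R E this] have z: "E = 0\<^sub>m n n" .
  show ?thesis
  proof (rule eq_matI)
    fix i j assume "i < dim_row R'" "j < dim_col R'"
    moreover from this have "E $$ (i, j) = 0" unfolding z using Rdim by simp
    ultimately show "R $$ (i, j) = R' $$ (i, j)" using Rdim by (simp add: E_def)
  qed (use Rdim in auto)
qed

lemma mat_sqrt_spd:
  assumes "spd_mat n G"
  shows "spd_mat n (mat_sqrt G)" "mat_sqrt G * mat_sqrt G = G"
proof -
  have n: "dim_row G = n" using assms by (auto simp: spd_mat_def)
  obtain R where R: "spd_mat n R" "R * R = G" using spd_sqrt_exists[OF assms] by blast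
  have "mat_sqrt G = R"
    unfolding mat_sqrt_def n
  proof (rule the_equality)
    fix R' assume "spd_mat n R' \<and> R' * R' = G"
    then show "R' = R" using spd_sqrt_unique[of n R' R] R by metis
  qed (use R in blast)
  with R show "spd_mat n (mat_sqrt G)" "mat_sqrt G * mat_sqrt G = G" by auto
qed

lemma spd_mat_inv:
  assumes "spd_mat n B"
  shows "spd_mat n (mat_inv B)" "B * mat_inv B = 1\<^sub>m n" "mat_inv B * B = 1\<^sub>m n"
proof -
  have B: "B \<in> carrier_mat n n" "B\<^sup>T = B" using assms by (auto simp: spd_mat_def)
  have "det B \<noteq> 0"
  proof
    assume "det B = 0"
    then obtain v where v: "v \<in> carrier_vec n" "v \<noteq> 0\<^sub>v n" "B *\<^sub>v v = 0\<^sub>v n"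
      using det_0_iff_vec_prod_zero_field[OF B(1)] by auto
    then have "0 < v \<bullet> 0\<^sub>v n" using assms unfolding spd_mat_def by metis
    with v show False by simp
  qed
  then have "B \<in> Units (ring_mat TYPE(real) n ())" by (rule det_non_zero_imp_unit[OF B(1)])
  then obtain X where X: "mat_inverse B = Some X"
    using mat_inverse(1)[OF B(1), where b = "()"] by (cases "mat_inverse B") auto
  then have inv: "mat_inv B = X" by (simp add: mat_inv_def)
  from mat_inverse(2)[OF B(1) X] have BX: "B * X = 1\<^sub>m n" "X * B = 1\<^sub>m n" and Xc: "X \<in> carrier_mat n n" by auto
  show "B * mat_inv B = 1\<^sub>m n" "mat_inv B * B = 1\<^sub>m n" using BX inv by auto
  have dims: "dim_row B = n" "dim_col B = n" "dim_row X = n" "dim_col X = n" using B Xc by auto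
  have XT: "X\<^sup>T = X"
  proof -
    have "X\<^sup>T * B = (B * X)\<^sup>T" using dims B by (simp add: transpose_mult_dim)
    then have XTB: "X\<^sup>T * B = 1\<^sub>m n" unfolding BX by simp
    have "X\<^sup>T = X\<^sup>T * (B * X)" using BX dims Xc by simp
    also have "\<dots> = (X\<^sup>T * B) * X" using dims by (simp add: mult_assoc_dim)
    also have "\<dots> = X" using XTB Xc by simp
    finally show ?thesis .
  qed
  have "0 < x \<bullet> (X *\<^sub>v x)" if x: "x \<in> carrier_vec n" "x \<noteq> 0\<^sub>v n" for x
  proof -
    define z where "z = X *\<^sub>v x"
    have z: "z \<in> carrier_vec n" using Xc x by (simp add: z_def)
    have xz: "x = B *\<^sub>v z"
    proof -
      have "B *\<^sub>v z = (B * X) *\<^sub>v x" unfolding z_def using dims x by (simp add: mult_vec_assoc_dim)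
      then show ?thesis using BX x by simp
    qed
    have "z \<noteq> 0\<^sub>v n" using xz x B by auto
    then have "0 < z \<bullet> (B *\<^sub>v z)" using assms z by (auto simp: spd_mat_def)
    then have "0 < z \<bullet> x" by (simp add: xz[symmetric])
    then show ?thesis unfolding z_def[symmetric] using comm_scalar_prod[OF z x(1)] by simp
  qed
  then show "spd_mat n (mat_inv B)" unfolding inv spd_mat_def using XT Xc by auto
qed

section \<open>The pseudoinverse of a symmetric matrix\<close>

lemma is_pinv_unique:
  assumes X: "is_pinv G X" and Y: "is_pinv G Y"
  shows "X = Y"
proof -
  have dims: "dim_row X = dim_col G" "dim_col X = dim_row G" "dim_row Y = dim_col G" "dim_col Y = dim_row G"
    using X Y by (auto simp: is_pinv_def)
  have x: "G * (X * G) = G" "X * (G * X) = X" "(G * X)\<^sup>T = G * X" "(X * G)\<^sup>T = X * G"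
    and y: "G * (Y * G) = G" "Y * (G * Y) = Y" "(G * Y)\<^sup>T = G * Y" "(Y * G)\<^sup>T = Y * G"
    using X Y dims by (auto simp: is_pinv_def mult_assoc_dim)
  have GX: "G * X = G * Y"
  proof -
    have "G * X = (G * (Y * G) * X)\<^sup>T" using x y by simp
    also have "\<dots> = ((G * Y) * (G * X))\<^sup>T" using dims by (simp add: mult_assoc_dim)
    also have "\<dots> = (G * X) * (G * Y)" using dims x y by (simp add: transpose_mult_dim[of "G * Y" "G * X"])
    also have "\<dots> = (G * (X * G)) * Y" using dims by (simp add: mult_assoc_dim)
    finally show ?thesis using x by simp
  qed
  have XG: "X * G = Y * G"
  proof -
    have "X * G = (X * (G * (Y * G)))\<^sup>T" using x y by simp
    also have "\<dots> = ((X * G) * (Y * G))\<^sup>T" using dims by (simp add: mult_assoc_dim)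
    also have "\<dots> = (Y * G) * (X * G)" using dims x y by (simp add: transpose_mult_dim[of "X * G" "Y * G"])
    also have "\<dots> = Y * (G * (X * G))" using dims by (simp add: mult_assoc_dim)
    finally show ?thesis using x by simp
  qed
  have "X = X * (G * Y)" using x GX by simp
  also have "\<dots> = (X * G) * Y" using dims by (simp add: mult_assoc_dim)
  also have "\<dots> = Y * (G * Y)" unfolding XG using dims by (simp add: mult_assoc_dim)
  finally show ?thesis using y by simp
qed

text \<open>In an eigenbasis the pseudoinverse inverts the nonzero eigenvalues; the convention
\<open>inverse 0 = 0\<close> does the right thing at the others. Hence it is symmetric and commutes with \<open>G\<close>.\<close>

lemma pinv_symmetric:
  assumes G: "G \<in> carrier_mat k k" "G\<^sup>T = G"
  shows "pinv G \<in> carrier_mat k k" "(pinv G)\<^sup>T = pinv G" "G * pinv G * G = G"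
    "pinv G * G * pinv G = pinv G" "G * pinv G = pinv G * G"
proof -
  obtain Q d where Q: "orthonormal_mat k Q" and Gd: "G = spectral_mat k Q d"
    using spectral_theorem[OF G] by blast
  define X where "X = spectral_mat k Q (\<lambda>i. inverse (d i))"
  have *: "(\<lambda>i. d i * inverse (d i) * d i) = d" "(\<lambda>i. inverse (d i) * d i * inverse (d i)) = (\<lambda>i. inverse (d i))"
    by (rule ext; simp add: field_simps)+
  have "is_pinv G X"
    unfolding is_pinv_def Gd X_def
    using carrier_matD[OF spectral_mat_carrier[OF Q]] Q
    by (simp add: spectral_mat_mult spectral_mat_transpose *)
  then have "pinv G = X"
    unfolding pinv_def by (rule the_equality) (rule is_pinv_unique[OF _ \<open>is_pinv G X\<close>])
  then show "pinv G \<in> carrier_mat k k" "(pinv G)\<^sup>T = pinv G" "G * pinv G * G = G"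
    "pinv G * G * pinv G = pinv G" "G * pinv G = pinv G * G"
    using \<open>is_pinv G X\<close> Q by (auto simp: is_pinv_def X_def Gd spectral_mat_transpose spectral_mat_mult mult.commute)
qed

section \<open>Extreme eigenvalues and the Rayleigh quotient\<close>

lemma finite_eigenvalues:
  fixes W :: "real mat"
  assumes "W \<in> carrier_mat n n"
  shows "finite {l. eigenvalue W l}"
proof -
  have "char_poly W \<noteq> 0" using degree_monic_char_poly[OF assms] by auto
  then show ?thesis
    unfolding eigenvalue_root_char_poly[OF assms] by (rule poly_roots_finite)
qed

lemma spectral_mat_eigenvalue:
  assumes "orthonormal_mat n Q" "k < n"
  shows "eigenvalue (spectral_mat n Q d) (d k)"
  unfolding eigenvalue_def eigenvector_def
  using orthonormal_mat_col[OF assms] spectral_mat_eigenvector[OF assms]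
    carrier_matD[OF spectral_mat_carrier[OF assms(1)]] by auto

lemma rayleigh_le_lambda_max:
  assumes W: "W \<in> carrier_mat n n" "W\<^sup>T = W" and x: "x \<in> carrier_vec n"
  shows "x \<bullet> (W *\<^sub>v x) \<le> lambda_max W * (x \<bullet> x)"
proof -
  obtain Q d where Q: "orthonormal_mat n Q" and Wd: "W = spectral_mat n Q d"
    using spectral_theorem[OF W] by blast
  have "d k \<le> lambda_max W" if "k < n" for k
    unfolding lambda_max_def
    using spectral_mat_eigenvalue[OF Q that] finite_eigenvalues[OF W(1)] by (intro Max_ge) (auto simp: Wd)
  then have "(\<Sum>k<n. d k * (col Q k \<bullet> x)\<^sup>2) \<le> (\<Sum>k<n. lambda_max W * (col Q k \<bullet> x)\<^sup>2)"
    by (intro sum_mono mult_right_mono) auto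
  then show ?thesis
    unfolding orthonormal_mat_parseval[OF Q x] sum_distrib_left
    by (simp add: Wd spectral_mat_quadratic_form[OF Q x])
qed

text \<open>In an eigenbasis of \<open>W\<close>, the coordinates of \<open>x\<close> along the kernel vanish by hypothesis, and along
every other basis vector the eigenvalue is one of those over which the minimum is taken.\<close>

lemma rayleigh_ge_lambda_min_pos:
  assumes W: "W \<in> carrier_mat n n" "W\<^sup>T = W" and x: "x \<in> carrier_vec n"
    and perp: "\<And>z. z \<in> carrier_vec n \<Longrightarrow> W *\<^sub>v z = 0\<^sub>v n \<Longrightarrow> z \<bullet> x = 0"
  shows "lambda_min_pos W * (x \<bullet> x) \<le> x \<bullet> (W *\<^sub>v x)"
proof -
  obtain Q d where Q: "orthonormal_mat n Q" and Wd: "W = spectral_mat n Q d"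
    using spectral_theorem[OF W] by blast
  have "lambda_min_pos W * (col Q k \<bullet> x)\<^sup>2 \<le> d k * (col Q k \<bullet> x)\<^sup>2" if k: "k < n" for k
  proof (cases "d k = 0")
    case True
    have "col Q k \<bullet> x = 0"
    proof (rule perp)
      have "0 \<cdot>\<^sub>v col Q k = 0\<^sub>v n"
        using carrier_vecD[OF orthonormal_mat_col(1)[OF Q k]] by (intro eq_vecI) auto
      then show "W *\<^sub>v col Q k = 0\<^sub>v n"
        using True spectral_mat_eigenvector[OF Q k, of d] by (simp add: Wd)
    qed (use orthonormal_mat_col[OF Q k] in simp)
    then show ?thesis by simp
  next
    case False
    have "finite {l. eigenvalue W l \<and> l \<noteq> 0}"
      using finite_eigenvalues[OF W(1)] by (rule rev_finite_subset) auto
    then have "lambda_min_pos W \<le> d k"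
      unfolding lambda_min_pos_def
      using spectral_mat_eigenvalue[OF Q k, of d] False by (intro Min_le) (auto simp: Wd)
    then show ?thesis by (intro mult_right_mono) auto
  qed
  then have "(\<Sum>k<n. lambda_min_pos W * (col Q k \<bullet> x)\<^sup>2) \<le> (\<Sum>k<n. d k * (col Q k \<bullet> x)\<^sup>2)"
    by (intro sum_mono) auto
  then show ?thesis
    unfolding orthonormal_mat_parseval[OF Q x] sum_distrib_left
    by (simp add: Wd spectral_mat_quadratic_form[OF Q x])
qed

section \<open>Orthogonal projection onto the range of a matrix\<close>

definition range_proj :: "real mat \<Rightarrow> real mat" where
  "range_proj C = C * pinv (C\<^sup>T * C) * C\<^sup>T"

context
  fixes C :: "real mat" and n k :: nat
  assumes C: "C \<in> carrier_mat n k"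
begin

lemma gram_symmetric: "C\<^sup>T * C \<in> carrier_mat k k" "(C\<^sup>T * C)\<^sup>T = C\<^sup>T * C"
  using C by (auto simp: transpose_mult_dim)

lemma dims_gram [simp]: "dim_row C = n" "dim_col C = k" "dim_row (pinv (C\<^sup>T * C)) = k" "dim_col (pinv (C\<^sup>T * C)) = k"
  using carrier_matD[OF C] carrier_matD[OF pinv_symmetric(1)[OF gram_symmetric]] by simp_all

lemma range_proj_carrier: "range_proj C \<in> carrier_mat n n"
  by (rule carrier_matI) (simp_all add: range_proj_def)

text \<open>With \<open>G = C\<^sup>T C\<close> and \<open>F = G\<^sup>\<dagger> G - I\<close>, the Gram matrix of \<open>C F\<close> is \<open>F\<^sup>T G F\<close>, which vanishes because
\<open>G G\<^sup>\<dagger> G = G\<close>; hence \<open>C F = 0\<close>.\<close>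

lemma mult_pinv_gram: "C * (pinv (C\<^sup>T * C) * (C\<^sup>T * C)) = C"
proof -
  define G where "G = C\<^sup>T * C"
  define X where "X = pinv G"
  have GX: "G * X * G = G" and XT: "X\<^sup>T = X" and Xc: "X \<in> carrier_mat k k" and Gc: "G \<in> carrier_mat k k" "G\<^sup>T = G"
    using pinv_symmetric[OF gram_symmetric] gram_symmetric by (auto simp: X_def G_def)
  have d: "dim_row X = k" "dim_col X = k" "dim_row G = k" "dim_col G = k" using Xc Gc by auto
  define F where "F = X * G - 1\<^sub>m k"
  have F: "F \<in> carrier_mat k k" unfolding F_def by (rule minus_carrier_mat) simp
  have dF: "dim_row F = k" "dim_col F = k" using F by auto
  have GF: "G * F = 0\<^sub>m k k"
  proof -
    have "G * F = G * (X * G) - G * 1\<^sub>m k"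
      unfolding F_def using Xc Gc by (intro mult_minus_distrib_mat[of _ k k _ k]) auto
    also have "\<dots> = G - G" using GX Gc d by (simp add: mult_assoc_dim)
    finally show ?thesis using Gc by (simp add: minus_r_inv_mat)
  qed
  have "(C * F)\<^sup>T * (C * F) = F\<^sup>T * (G * F)"
    using dF by (simp add: G_def mat_dims)
  also have "\<dots> = 0\<^sub>m k k" using F unfolding GF by simp
  finally have "C * F = 0\<^sub>m n k" using transpose_mult_self_eq_0[of "C * F"] dF by simp
  moreover have "C * F = C * (X * G) - C * 1\<^sub>m k"
    unfolding F_def using C Xc Gc by (intro mult_minus_distrib_mat[of _ n k _ k]) auto
  ultimately have "C * (X * G) - C = 0\<^sub>m n k" using C by simp
  then have *: "(C * (X * G) - C) $$ (i, j) = 0" if "i < n" "j < k" for i j using that by simp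
  have "C * (X * G) = C"
  proof (rule eq_matI)
    fix i j assume "i < dim_row C" "j < dim_col C"
    then show "(C * (X * G)) $$ (i, j) = C $$ (i, j)"
      using *[of i j] d by (simp del: index_mult_mat(1))
  qed (use d in auto)
  then show ?thesis by (simp add: X_def G_def)
qed

lemma range_proj_transpose: "(range_proj C)\<^sup>T = range_proj C"
  using pinv_symmetric(2)[OF gram_symmetric] by (simp add: range_proj_def mat_dims)

lemma range_proj_mult: "range_proj C * C = C"
  using mult_pinv_gram by (simp add: range_proj_def mat_dims)

lemma range_proj_idem: "range_proj C * range_proj C = range_proj C"
proof -
  have "range_proj C * range_proj C = (range_proj C * C) * (pinv (C\<^sup>T * C) * C\<^sup>T)"
    using range_proj_carrier by (simp add: range_proj_def mat_dims)
  then show ?thesis unfolding range_proj_mult by (simp add: range_proj_def mat_dims)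
qed

text \<open>\<open>G\<^sup>\<dagger> = G G\<^sup>\<dagger> G\<^sup>\<dagger>\<close> moves a factor \<open>C C\<^sup>T\<close> to the left. This factor is what the powers in the limit below
annihilate.\<close>

lemma range_proj_factor:
  obtains Y where "Y \<in> carrier_mat n n" "range_proj C = C * C\<^sup>T * Y"
proof -
  define X where "X = pinv (C\<^sup>T * C)"
  have d: "dim_row X = k" "dim_col X = k" by (simp_all add: X_def)
  have "X = (X * (C\<^sup>T * C)) * X"
    using pinv_symmetric(4)[OF gram_symmetric] by (simp add: X_def)
  also have "X * (C\<^sup>T * C) = (C\<^sup>T * C) * X"
    using pinv_symmetric(5)[OF gram_symmetric] by (simp add: X_def)
  finally have "range_proj C = C * ((C\<^sup>T * C) * X * X) * C\<^sup>T"
    by (simp add: range_proj_def X_def[symmetric])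
  also have "\<dots> = C * C\<^sup>T * (C * (X * (X * C\<^sup>T)))" using d by (simp add: mat_dims)
  finally have "range_proj C = C * C\<^sup>T * (C * (X * (X * C\<^sup>T)))" .
  moreover have "C * (X * (X * C\<^sup>T)) \<in> carrier_mat n n" by (rule carrier_matI) simp_all
  ultimately show ?thesis by (rule that[rotated])
qed

text \<open>Any bound for the eigenvalues of \<open>C C\<^sup>T\<close> would serve as the denominator. The sum of the absolute values of the
entries is one that is visibly a measurable function of them, and the summand 1 avoids a
division by zero.\<close>

definition "gram_scale = 1 / (1 + (\<Sum>i<n. \<Sum>j<n. \<bar>(C * C\<^sup>T) $$ (i, j)\<bar>))"

text \<open>Gradient descent for \<open>K = C C\<^sup>T\<close>: the matrix \<open>T = I - c K\<close> has eigenvalue 1 on the kernel of \<open>K\<close> and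
eigenvalues in \<open>[0, 1)\<close> elsewhere, so its powers converge to the projection onto the kernel.
Concretely, \<open>T\<^sup>N = (I - P) + T\<^sup>N K Y\<close> for \<open>P = K Y\<close>, and the eigenvalues \<open>(1 - c d)\<^sup>N d\<close> of \<open>T\<^sup>N K\<close> tend
to 0. The left-hand side is polynomial in \<open>c\<close> and the entries of \<open>K\<close>, so its limit inherits
measurability, which is not apparent from the pseudoinverse.\<close>

lemma range_proj_limit:
  assumes ij: "i < n" "j < n"
  shows "(\<lambda>N. ((1\<^sub>m n - gram_scale \<cdot>\<^sub>m (C * C\<^sup>T)) ^\<^sub>m N) $$ (i, j)) \<longlonglongrightarrow> (1\<^sub>m n - range_proj C) $$ (i, j)"
proof -
  define K where "K = C * C\<^sup>T"
  define s where "s = (\<Sum>i<n. \<Sum>j<n. \<bar>K $$ (i, j)\<bar>)"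
  define c where "c = 1 / (1 + s)"
  have s: "0 \<le> s" by (simp add: s_def sum_nonneg)
  have c_eq: "gram_scale = c" by (simp add: gram_scale_def c_def s_def K_def)
  have K: "K \<in> carrier_mat n n" "K\<^sup>T = K" by (simp_all add: K_def mat_dims carrier_matI)
  obtain Q d where Q: "orthonormal_mat n Q" and Kd: "K = spectral_mat n Q d"
    using spectral_theorem[OF K] by blast
  have dK: "dim_row K = n" "dim_col K = n" using K by auto
  have quad: "d l = col Q l \<bullet> (K *\<^sub>v col Q l)" if "l < n" for l
    using orthonormal_mat_col[OF Q that] spectral_mat_eigenvector[OF Q that, of d] by (simp add: Kd)
  have d0: "0 \<le> d l" if "l < n" for l
  proof -
    have cQ: "dim_vec (col Q l) = n" using carrier_vecD[OF orthonormal_mat_col(1)[OF Q that]] .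
    then have "col Q l \<bullet> (K *\<^sub>v col Q l) = (C\<^sup>T *\<^sub>v col Q l) \<bullet> (C\<^sup>T *\<^sub>v col Q l)"
      by (simp add: K_def mult_vec_assoc_dim scalar_prod_mult_vec[of C])
    then show ?thesis using scalar_prod_self_nonneg quad[OF that] by simp
  qed
  have ds: "d l \<le> s" if "l < n" for l
  proof -
    define u where "u = col Q l"
    have u: "u \<in> carrier_vec n" "u \<bullet> u = 1" using orthonormal_mat_col[OF Q that] by (auto simp: u_def)
    have u1: "\<bar>u $ i\<bar> \<le> 1" if "i < n" for i
    proof -
      have "u $ i * u $ i \<le> (\<Sum>i<n. u $ i * u $ i)" using that by (intro member_le_sum) auto
      also have "\<dots> = 1" using u by (simp add: scalar_prod_def atLeast0LessThan)
      finally have "\<bar>u $ i\<bar>\<^sup>2 \<le> 1\<^sup>2" by (simp add: power2_eq_square)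
      then show ?thesis by (rule power2_le_imp_le) simp
    qed
    have "d l = (\<Sum>i<n. \<Sum>j<n. u $ i * K $$ (i, j) * u $ j)"
      using quad[OF that] u dK unfolding u_def[symmetric]
      by (simp add: scalar_prod_def atLeast0LessThan sum_distrib_left mult.assoc)
    also have "\<dots> \<le> s"
      unfolding s_def
    proof (intro sum_mono)
      fix i j assume "i \<in> {..<n}" "j \<in> {..<n}"
      then have "\<bar>u $ i\<bar> * \<bar>u $ j\<bar> \<le> 1 * 1" using u1 by (intro mult_mono) auto
      then have "\<bar>u $ i\<bar> * \<bar>u $ j\<bar> * \<bar>K $$ (i, j)\<bar> \<le> 1 * \<bar>K $$ (i, j)\<bar>" by (intro mult_right_mono) auto
      then have "\<bar>u $ i * K $$ (i, j) * u $ j\<bar> \<le> \<bar>K $$ (i, j)\<bar>" by (simp add: abs_mult ac_simps)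
      then show "u $ i * K $$ (i, j) * u $ j \<le> \<bar>K $$ (i, j)\<bar>" by linarith
    qed
    finally show ?thesis .
  qed
  define T where "T = 1\<^sub>m n - c \<cdot>\<^sub>m K"
  have T: "T = spectral_mat n Q (\<lambda>l. 1 - c * d l)"
  proof (rule eq_matI)
    fix i j assume "i < dim_row (spectral_mat n Q (\<lambda>l. 1 - c * d l))" "j < dim_col (spectral_mat n Q (\<lambda>l. 1 - c * d l))"
    then have ij: "i < n" "j < n" by (auto simp: carrier_matD[OF spectral_mat_carrier[OF Q]])
    have "(1\<^sub>m n :: real mat) $$ (i, j) = (\<Sum>l<n. Q $$ (i, l) * 1 * Q $$ (j, l))"
      using spectral_mat_index[OF Q ij, of "\<lambda>_. 1"] by (simp add: spectral_mat_one[OF Q])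
    then show "T $$ (i, j) = spectral_mat n Q (\<lambda>l. 1 - c * d l) $$ (i, j)"
      using ij dK unfolding T_def spectral_mat_index[OF Q ij]
      by (simp add: Kd spectral_mat_index[OF Q ij] sum_distrib_left sum_subtractf[symmetric] algebra_simps)
  qed (auto simp: T_def dK carrier_matD[OF spectral_mat_carrier[OF Q]])
  have Tn: "T \<in> carrier_mat n n" using T Q by simp
  have pow: "T ^\<^sub>m N = spectral_mat n Q (\<lambda>l. (1 - c * d l) ^ N)" for N
  proof (induction N)
    case 0
    then show ?case using carrier_matD[OF Tn] by (simp add: spectral_mat_one[OF Q])
  next
    case (Suc N)
    have "T ^\<^sub>m Suc N = spectral_mat n Q (\<lambda>l. (1 - c * d l) ^ N) * T" using Suc by simp
    also have "\<dots> = spectral_mat n Q (\<lambda>l. (1 - c * d l) ^ Suc N)"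
      unfolding T spectral_mat_mult[OF Q] by (simp add: mult.commute)
    finally show ?case .
  qed
  define P where "P = range_proj C"
  have P: "P \<in> carrier_mat n n" "P\<^sup>T = P" "P * C = C"
    using range_proj_carrier range_proj_transpose range_proj_mult by (auto simp: P_def)
  have dP: "dim_row P = n" "dim_col P = n" using P by auto
  have PK: "P * K = K" using P dP by (simp add: K_def flip: mult_assoc_dim)
  have KP: "K * P = K"
    using arg_cong[OF PK, of transpose_mat] dP dK K P by (simp add: transpose_mult_dim)
  define O' where "O' = 1\<^sub>m n - P"
  have O': "O' \<in> carrier_mat n n" unfolding O'_def by (rule minus_carrier_mat[OF P(1)])
  have "K * O' = K * 1\<^sub>m n - K * P"
    unfolding O'_def using K P by (intro mult_minus_distrib_mat[of _ n n _ n]) auto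
  then have KO: "K * O' = 0\<^sub>m n n" using K KP by (simp add: minus_r_inv_mat)
  have "T * O' = 1\<^sub>m n * O' - (c \<cdot>\<^sub>m K) * O'"
    unfolding T_def using K O' by (intro minus_mult_distrib_mat[of _ n n _ _ n]) auto
  also have "(c \<cdot>\<^sub>m K) * O' = 0\<^sub>m n n" using KO K O' by (simp add: mult_smult_assoc_mat[of _ n n _ n])
  finally have TO: "T * O' = O'" using O' by (auto intro!: eq_matI)
  have powO: "T ^\<^sub>m N * O' = O'" for N
  proof (induction N)
    case (Suc N)
    have "T ^\<^sub>m Suc N * O' = T ^\<^sub>m N * (T * O')"
      using Tn O' by (simp add: assoc_mult_mat[of _ n n _ n _ n])
    then show ?case using Suc TO by simp
  qed (use Tn O' in auto)
  obtain Y where Y: "Y \<in> carrier_mat n n" "P = K * Y"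
    using range_proj_factor unfolding P_def K_def by blast
  define E where "E N = spectral_mat n Q (\<lambda>l. (1 - c * d l) ^ N * d l)" for N
  have powK: "T ^\<^sub>m N * K = E N" for N unfolding pow Kd E_def by (rule spectral_mat_mult[OF Q])
  have decomp: "T ^\<^sub>m N = O' + E N * Y" for N
  proof -
    have TN: "T ^\<^sub>m N \<in> carrier_mat n n" using Tn by simp
    have "1\<^sub>m n = O' + P" unfolding O'_def using P by (intro eq_matI) auto
    then have "T ^\<^sub>m N = T ^\<^sub>m N * (O' + P)" using TN by (metis right_mult_one_mat)
    also have "\<dots> = T ^\<^sub>m N * O' + T ^\<^sub>m N * P"
      using TN O' P by (intro mult_add_distrib_mat[of _ n n _ n]) auto
    also have "T ^\<^sub>m N * P = E N * Y"
      unfolding Y(2) powK[symmetric] using TN K Y by (simp add: assoc_mult_mat[of _ n n _ n _ n])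
    finally show ?thesis by (simp add: powO)
  qed
  have E0: "(\<lambda>N. E N $$ (a, b)) \<longlonglongrightarrow> 0" if ab: "a < n" "b < n" for a b
  proof -
    have "(\<lambda>N. (1 - c * d l) ^ N * d l) \<longlonglongrightarrow> 0" if l: "l < n" for l
    proof (cases "d l = 0")
      case False
      then have pos: "0 < d l" using d0[OF l] by simp
      have "0 < c" using s by (simp add: c_def)
      have "c * d l < 1" using ds[OF l] s by (simp add: c_def divide_less_eq)
      then have "\<bar>1 - c * d l\<bar> < 1" using mult_pos_pos[OF \<open>0 < c\<close> pos] by simp
      then have "(\<lambda>N. (1 - c * d l) ^ N) \<longlonglongrightarrow> 0" by (intro LIMSEQ_power_zero) simp
      then show ?thesis by (rule tendsto_mult_left_zero)
    qed simp
    then have "(\<lambda>N. \<Sum>l<n. Q $$ (a, l) * ((1 - c * d l) ^ N * d l) * Q $$ (b, l)) \<longlonglongrightarrow> (\<Sum>l<n. Q $$ (a, l) * 0 * Q $$ (b, l))"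
      by (intro tendsto_intros) auto
    then show ?thesis by (simp add: E_def spectral_mat_index[OF Q ab])
  qed
  have "(\<lambda>N. O' $$ (i, j) + (\<Sum>l<n. E N $$ (i, l) * Y $$ (l, j))) \<longlonglongrightarrow> O' $$ (i, j) + (\<Sum>l<n. 0 * Y $$ (l, j))"
    using ij by (intro tendsto_intros E0) auto
  moreover have "(T ^\<^sub>m N) $$ (i, j) = O' $$ (i, j) + (\<Sum>l<n. E N $$ (i, l) * Y $$ (l, j))" for N
  proof -
    have "E N \<in> carrier_mat n n" using Q by (simp add: E_def)
    then show ?thesis
      unfolding decomp using ij Y O' by (simp add: scalar_prod_def atLeast0LessThan)
  qed
  ultimately show ?thesis
    by (simp add: T_def c_eq K_def[symmetric] O'_def[symmetric] P_def[symmetric])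
qed

end

declare dims_gram [simp del]

section \<open>Measurability of the projection\<close>

lemma borel_measurable_pow_mat:
  fixes T :: "'a \<Rightarrow> real mat"
  assumes T: "\<And>s. s \<in> space M \<Longrightarrow> T s \<in> carrier_mat n n"
    and meas: "\<And>i j. i < n \<Longrightarrow> j < n \<Longrightarrow> (\<lambda>s. T s $$ (i, j)) \<in> borel_measurable M"
    and ij: "i < n" "j < n"
  shows "(\<lambda>s. (T s ^\<^sub>m N) $$ (i, j)) \<in> borel_measurable M"
  using ij
proof (induction N arbitrary: i j)
  case 0
  have "(\<lambda>s. (T s ^\<^sub>m 0) $$ (i, j)) \<in> borel_measurable M \<longleftrightarrow> (\<lambda>s. if i = j then 1 else 0 :: real) \<in> borel_measurable M"
  proof (rule measurable_cong)
    fix s assume "s \<in> space M"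
    then show "(T s ^\<^sub>m 0) $$ (i, j) = (if i = j then 1 else 0)" using T[of s] 0 by auto
  qed
  then show ?case by simp
next
  case (Suc N)
  have "(\<lambda>s. (T s ^\<^sub>m Suc N) $$ (i, j)) \<in> borel_measurable M
      \<longleftrightarrow> (\<lambda>s. \<Sum>k<n. (T s ^\<^sub>m N) $$ (i, k) * T s $$ (k, j)) \<in> borel_measurable M"
  proof (rule measurable_cong)
    fix s assume "s \<in> space M"
    then have T': "T s \<in> carrier_mat n n" "T s ^\<^sub>m N \<in> carrier_mat n n" using T by auto
    then show "(T s ^\<^sub>m Suc N) $$ (i, j) = (\<Sum>k<n. (T s ^\<^sub>m N) $$ (i, k) * T s $$ (k, j))"
      using Suc.prems carrier_matD[OF T'(1)] carrier_matD[OF T'(2)] by (simp add: scalar_prod_def atLeast0LessThan)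
  qed
  moreover have "(\<lambda>s. \<Sum>k<n. (T s ^\<^sub>m N) $$ (i, k) * T s $$ (k, j)) \<in> borel_measurable M"
    using Suc meas by (intro borel_measurable_sum borel_measurable_times) auto
  ultimately show ?case by blast
qed

lemma borel_measurable_range_proj:
  fixes C :: "'a \<Rightarrow> real mat"
  assumes C: "\<And>s. s \<in> space M \<Longrightarrow> dim_row (C s) = n"
    and meas: "\<And>i j. i < n \<Longrightarrow> j < n \<Longrightarrow> (\<lambda>s. (C s * (C s)\<^sup>T) $$ (i, j)) \<in> borel_measurable M"
    and ij: "i < n" "j < n"
  shows "(\<lambda>s. range_proj (C s) $$ (i, j)) \<in> borel_measurable M"
proof -
  define T where "T s = 1\<^sub>m n - gram_scale (C s) n \<cdot>\<^sub>m (C s * (C s)\<^sup>T)" for s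
  have Cs: "C s \<in> carrier_mat n (dim_col (C s))" if "s \<in> space M" for s
    using C[OF that] by auto
  have gs: "(\<lambda>s. gram_scale (C s) n) \<in> borel_measurable M"
  proof -
    have "(\<lambda>s. gram_scale (C s) n) \<in> borel_measurable M \<longleftrightarrow>
        (\<lambda>s. 1 / (1 + (\<Sum>i<n. \<Sum>j<n. \<bar>(C s * (C s)\<^sup>T) $$ (i, j)\<bar>))) \<in> borel_measurable M"
      by (rule measurable_cong) (use gram_scale_def[OF Cs] in simp)
    then show ?thesis using meas by simp
  qed
  have T: "T s \<in> carrier_mat n n" if "s \<in> space M" for s
    using C[OF that] unfolding T_def by (intro minus_carrier_mat smult_carrier_mat carrier_matI) auto
  have "(\<lambda>s. T s $$ (i, j)) \<in> borel_measurable M" if "i < n" "j < n" for i j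
  proof -
    have "(\<lambda>s. T s $$ (i, j)) \<in> borel_measurable M \<longleftrightarrow>
       (\<lambda>s. (if i = j then 1 else 0) - gram_scale (C s) n * (C s * (C s)\<^sup>T) $$ (i, j)) \<in> borel_measurable M"
      by (rule measurable_cong) (use C that in \<open>simp add: T_def\<close>)
    then show ?thesis using gs meas[OF that] by simp
  qed
  then have pow: "(\<lambda>s. (T s ^\<^sub>m N) $$ (i, j)) \<in> borel_measurable M" for N
    using T ij by (intro borel_measurable_pow_mat) auto
  have "(\<lambda>s. (1\<^sub>m n - range_proj (C s)) $$ (i, j)) \<in> borel_measurable M"
  proof (rule borel_measurable_LIMSEQ_real[OF _ pow])
    fix s assume "s \<in> space M"
    then show "(\<lambda>N. (T s ^\<^sub>m N) $$ (i, j)) \<longlonglongrightarrow> (1\<^sub>m n - range_proj (C s)) $$ (i, j)"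
      unfolding T_def using range_proj_limit[OF Cs ij] by blast
  qed
  then have "(\<lambda>s. (if i = j then 1 else 0) - (1\<^sub>m n - range_proj (C s)) $$ (i, j)) \<in> borel_measurable M"
    by simp
  moreover have "(\<lambda>s. (if i = j then 1 else 0) - (1\<^sub>m n - range_proj (C s)) $$ (i, j)) \<in> borel_measurable M \<longleftrightarrow> ?thesis"
  proof (rule measurable_cong)
    fix s assume "s \<in> space M"
    then have "range_proj (C s) \<in> carrier_mat n n" using range_proj_carrier[OF Cs] by blast
    then show "(if i = j then 1 else 0) - (1\<^sub>m n - range_proj (C s)) $$ (i, j) = range_proj (C s) $$ (i, j)"
      using ij by auto
  qed
  ultimately show ?thesis by blast
qed

lemma sketch_space_generator:
  "{carrier_mat m q | q. True} \<union> {{S \<in> carrier_mat m q. S $$ (i, j) \<in> U} | q i j U. i < m \<and> j < q \<and> U \<in> sets borel}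
     \<subseteq> Pow {S :: real mat. dim_row S = m}"
  by auto

lemma space_sketch_space: "space (sketch_space m) = {S. dim_row S = m}"
  unfolding sketch_space_def by (rule space_measure_of[OF sketch_space_generator])

lemma carrier_mat_in_sketch_space: "carrier_mat m q \<in> sets (sketch_space m)"
  unfolding sketch_space_def sets_measure_of[OF sketch_space_generator] by (rule sigma_sets.Basic) auto

text \<open>On the other strata of the sketch space the entry may not exist; the value 0 there makes it a function on the
whole space.\<close>

lemma borel_measurable_sketch_entry:
  assumes "i < m" "j < q"
  shows "(\<lambda>S. if S \<in> carrier_mat m q then S $$ (i, j) else 0) \<in> borel_measurable (sketch_space m)"
proof (rule measurableI)
  fix U :: "real set" assume U: "U \<in> sets borel"
  have 1: "{S \<in> carrier_mat m q. S $$ (i, j) \<in> U} \<in> sets (sketch_space m)"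
    unfolding sketch_space_def sets_measure_of[OF sketch_space_generator]
    using assms U by (intro sigma_sets.Basic) blast
  have 2: "space (sketch_space m) - carrier_mat m q \<in> sets (sketch_space m)"
    using carrier_mat_in_sketch_space by auto
  have "(\<lambda>S. if S \<in> carrier_mat m q then S $$ (i, j) else 0) -` U \<inter> space (sketch_space m)
      = {S \<in> carrier_mat m q. S $$ (i, j) \<in> U} \<union> (if 0 \<in> U then space (sketch_space m) - carrier_mat m q else {})"
    (is "?f -` U \<inter> ?\<Omega> = ?A \<union> ?B")
  proof (rule Set.set_eqI)
    fix S
    have "S \<in> carrier_mat m q \<Longrightarrow> S \<in> ?\<Omega>" by (simp add: space_sketch_space)
    then show "S \<in> ?f -` U \<inter> ?\<Omega> \<longleftrightarrow> S \<in> ?A \<union> ?B"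
      by (cases "S \<in> carrier_mat m q"; cases "0 \<in> U"; simp)
  qed
  with 1 2 show "(\<lambda>S. if S \<in> carrier_mat m q then S $$ (i, j) else 0) -` U \<inter> space (sketch_space m)
      \<in> sets (sketch_space m)" by auto
qed simp

text \<open>On each of the countably many strata of sketches with a fixed number of columns, the
entries of \<open>(L S) (L S)\<^sup>T\<close> are polynomials in the entries of \<open>S\<close>.\<close>

lemma borel_measurable_sketch_proj:
  assumes L: "L \<in> carrier_mat n m" and ij: "i < n" "j < n"
  shows "(\<lambda>S. range_proj (L * S) $$ (i, j)) \<in> borel_measurable (sketch_space m)"
proof (rule borel_measurable_range_proj[OF _ _ ij])
  fix i j assume ij: "i < n" "j < n"
  show "(\<lambda>S. (L * S * (L * S)\<^sup>T) $$ (i, j)) \<in> borel_measurable (sketch_space m)"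
  proof (rule measurable_piecewise_restrict2)
    fix q
    define e where "e r l S = (if S \<in> carrier_mat m q then S $$ (r, l) else 0)" for r l and S :: "real mat"
    define h where "h S = (\<Sum>l<q. (\<Sum>r<m. L $$ (i, r) * e r l S) * (\<Sum>r<m. L $$ (j, r) * e r l S))" for S
    have "h \<in> borel_measurable (sketch_space m)"
      unfolding h_def e_def
      by (intro borel_measurable_sum borel_measurable_times borel_measurable_const borel_measurable_sketch_entry) auto
    moreover have "(L * S * (L * S)\<^sup>T) $$ (i, j) = h S" if S: "S \<in> carrier_mat m q" for S
      using L ij S carrier_matD[OF L] carrier_matD[OF S]
      by (simp add: h_def e_def scalar_prod_def atLeast0LessThan)
    ultimately show "\<exists>h\<in>borel_measurable (sketch_space m). \<forall>S\<in>carrier_mat m q. (L * S * (L * S)\<^sup>T) $$ (i, j) = h S"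
      by blast
  qed (auto simp: carrier_mat_in_sketch_space space_sketch_space)
qed (use L in \<open>simp add: space_sketch_space\<close>)

text \<open>\<open>P = P\<^sup>T P\<close> writes a diagonal entry of \<open>P\<close> as the sum of the squares of its column; this bounds first the diagonal
entries and then all others by 1.\<close>

lemma range_proj_entry_bound:
  assumes C: "C \<in> carrier_mat n k" and ij: "i < n" "j < n"
  shows "\<bar>range_proj C $$ (i, j)\<bar> \<le> 1"
proof -
  define P where "P = range_proj C"
  have P: "P \<in> carrier_mat n n" "P\<^sup>T = P" "P * P = P"
    unfolding P_def using range_proj_carrier[OF C] range_proj_transpose[OF C] range_proj_idem[OF C] by auto
  have sym: "P $$ (a, b) = P $$ (b, a)" if "a < n" "b < n" for a b
    using that P by (metis carrier_matD index_transpose_mat(1))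
  have diag: "P $$ (j, j) = (\<Sum>a<n. (P $$ (a, j))\<^sup>2)" if "j < n" for j
  proof -
    have "(P * P) $$ (j, j) = (\<Sum>a<n. P $$ (j, a) * P $$ (a, j))"
      using P(1) that by (simp add: scalar_prod_def atLeast0LessThan)
    also have "\<dots> = (\<Sum>a<n. (P $$ (a, j))\<^sup>2)"
      by (rule sum.cong) (use that sym[of j] in \<open>auto simp: power2_eq_square\<close>)
    finally show ?thesis unfolding P(3) .
  qed
  have le: "(P $$ (i, j))\<^sup>2 \<le> P $$ (j, j)" if "i < n" "j < n" for i j
    unfolding diag[OF that(2)] using that by (intro member_le_sum) auto
  have "P $$ (j, j) \<le> 1"
    using le[OF ij(2) ij(2)] by (smt (verit) power2_eq_square mult_le_cancel_right2 mult_less_cancel_left1)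
  then have "\<bar>P $$ (i, j)\<bar>\<^sup>2 \<le> 1\<^sup>2" using le[OF ij] by simp
  then show ?thesis unfolding P_def by (rule power2_le_imp_le) simp
qed

section \<open>Two-term recursions\<close>

lemma two_term_recursion_rate:
  fixes a1 a2 q :: real
  assumes "0 \<le> a2" "a1 + a2 < 1" and q: "q = (a1 + sqrt (a1\<^sup>2 + 4 * a2)) / 2"
  shows "q * q = a1 * q + a2" "0 \<le> q" "a1 \<le> q" "a1 + a2 \<le> q" "q < 1"
proof -
  define r where "r = sqrt (a1\<^sup>2 + 4 * a2)"
  have r2: "r\<^sup>2 = a1\<^sup>2 + 4 * a2" using assms by (simp add: r_def)
  have "sqrt (a1\<^sup>2) \<le> r" unfolding r_def using assms by (intro real_sqrt_le_mono) simp
  then have abs: "\<bar>a1\<bar> \<le> r" by simp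
  have qr: "q = (a1 + r) / 2" by (simp add: q r_def)
  show root: "q * q = a1 * q + a2"
    using r2 by (simp add: qr power2_eq_square field_simps)
  show q0: "0 \<le> q" and a1q: "a1 \<le> q" using abs by (auto simp: qr)
  show q1: "q < 1"
  proof (rule ccontr)
    assume "\<not> q < 1"
    moreover have "q * (q - a1) = a2" using root by (simp add: algebra_simps)
    moreover have "1 - a1 \<le> q * (q - a1)" if "1 \<le> q"
      using mult_mono[of 1 q "1 - a1" "q - a1"] that a1q assms(1,2) by simp
    ultimately show False using assms by linarith
  qed
  have "a2 = q * (q - a1)" using root by (simp add: algebra_simps)
  also have "\<dots> \<le> 1 * (q - a1)" using q1 a1q by (intro mult_right_mono) auto
  finally show "a1 + a2 \<le> q" by simp
qed

text \<open>With \<open>\<delta> = q - a1\<close> the equation for \<open>q\<close> reads \<open>a2 = q \<delta>\<close>, so the combination \<open>F (k + 1) + \<delta> F k\<close>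
decreases by the factor \<open>q\<close> in each step.\<close>

lemma two_term_recursion_bound:
  fixes F :: "nat \<Rightarrow> real"
  assumes "\<And>k. 0 \<le> F k" "F 1 = F 0" "\<And>k. F (k + 2) \<le> a1 * F (k + 1) + a2 * F k"
    and q: "q * q = a1 * q + a2" "0 \<le> q" "a1 \<le> q"
  shows "F (k + 1) \<le> q ^ k * (1 + (q - a1)) * F 0"
proof -
  have "F (k + 1) + (q - a1) * F k \<le> q ^ k * (F 1 + (q - a1) * F 0)"
  proof (induction k)
    case (Suc k)
    have a2: "a2 = q * (q - a1)" using q by (simp add: algebra_simps)
    have "F (k + 2) + (q - a1) * F (k + 1) \<le> q * (F (k + 1) + (q - a1) * F k)"
      using assms(3)[of k] by (simp add: a2 algebra_simps)
    also have "\<dots> \<le> q * (q ^ k * (F 1 + (q - a1) * F 0))"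
      using Suc q by (intro mult_left_mono)
    finally show ?case by (simp add: mult.assoc)
  qed simp
  moreover have "0 \<le> (q - a1) * F k" using q assms(1) by simp
  ultimately show ?thesis using assms(2) by (simp add: algebra_simps)
qed

section \<open>Projection steps with momentum\<close>

definition orth_projection :: "nat \<Rightarrow> real mat \<Rightarrow> bool" where
  "orth_projection n P \<longleftrightarrow> P \<in> carrier_mat n n \<and> P\<^sup>T = P \<and> P * P = P"

lemma orth_projection_quadratic_form:
  assumes P: "orth_projection n P" and x: "x \<in> carrier_vec n" and y: "y \<in> carrier_vec n"
  shows "x \<bullet> (P *\<^sub>v y) = (P *\<^sub>v x) \<bullet> (P *\<^sub>v y)"
proof -
  have d: "dim_row P = n" "dim_col P = n" "dim_vec x = n" "dim_vec y = n"
    using assms by (auto simp: orth_projection_def)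
  have "x \<bullet> (P *\<^sub>v y) = x \<bullet> (P *\<^sub>v (P *\<^sub>v y))"
    using P d by (simp add: orth_projection_def flip: mult_vec_assoc_dim)
  also have "\<dots> = (P\<^sup>T *\<^sub>v x) \<bullet> (P *\<^sub>v y)" using d by (intro scalar_prod_mult_vec) simp_all
  finally show ?thesis using P by (simp add: orth_projection_def)
qed

lemma orth_projection_nonneg:
  assumes "orth_projection n P" "x \<in> carrier_vec n"
  shows "0 \<le> x \<bullet> (P *\<^sub>v x)"
  unfolding orth_projection_quadratic_form[OF assms(1,2,2)] by (rule scalar_prod_self_nonneg)

lemma orth_projection_le:
  assumes P: "orth_projection n P" and x: "x \<in> carrier_vec n"
  shows "x \<bullet> (P *\<^sub>v x) \<le> x \<bullet> x"
proof -
  have Px: "P *\<^sub>v x \<in> carrier_vec n" using P x by (auto simp: orth_projection_def)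
  have "0 \<le> (x - P *\<^sub>v x) \<bullet> (x - P *\<^sub>v x)" by (rule scalar_prod_self_nonneg)
  also have "\<dots> = x \<bullet> x - x \<bullet> (P *\<^sub>v x)"
    using x Px orth_projection_quadratic_form[OF P x x] comm_scalar_prod[OF Px x]
    by (simp add: scalar_prod_minus_distrib[of _ n] minus_scalar_prod_distrib[of _ n])
  finally show ?thesis by simp
qed

text \<open>Expand the square. The cross terms are absorbed by
\<open>- 2 x \<cdot> x' \<le> |x|\<^sup>2 + |x'|\<^sup>2\<close> and \<open>2 x' \<cdot> P x \<le> x \<cdot> P x + x' \<cdot> P x'\<close>, the latter being the
nonnegativity of \<open>|P x - P x'|\<^sup>2\<close>, and \<open>|P x|\<^sup>2 = x \<cdot> P x\<close>. Once the forms
are estimated in expectation, the coefficients are those of \<open>a\<^sub>1\<close> and \<open>a\<^sub>2\<close>.\<close>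

lemma momentum_step_norm:
  fixes \<omega> \<beta> :: real
  assumes P: "orth_projection n P" and x: "x \<in> carrier_vec n" and x': "x' \<in> carrier_vec n"
    and \<omega>: "0 \<le> \<omega>" and \<beta>: "0 \<le> \<beta>"
  defines "z \<equiv> x - \<omega> \<cdot>\<^sub>v (P *\<^sub>v x) + \<beta> \<cdot>\<^sub>v (x - x')"
  shows "z \<bullet> z \<le> (1 + 3 * \<beta> + 2 * \<beta>\<^sup>2) * (x \<bullet> x) - (\<omega> * (2 - \<omega>) + \<omega> * \<beta>) * (x \<bullet> (P *\<^sub>v x))
     + (\<beta> + 2 * \<beta>\<^sup>2) * (x' \<bullet> x') + \<omega> * \<beta> * (x' \<bullet> (P *\<^sub>v x'))"
proof -
  define p p' where "p = P *\<^sub>v x" and "p' = P *\<^sub>v x'"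
  have c: "p \<in> carrier_vec n" "p' \<in> carrier_vec n"
    using P x x' mult_mat_vec_carrier[of P n n] by (auto simp: orth_projection_def p_def p'_def)
  have pp: "p \<bullet> p = x \<bullet> p" "p' \<bullet> p' = x' \<bullet> p'" "p' \<bullet> p = x' \<bullet> p"
    using orth_projection_quadratic_form[OF P x x] orth_projection_quadratic_form[OF P x' x']
      orth_projection_quadratic_form[OF P x' x] by (auto simp: p_def p'_def)
  have comm: "p \<bullet> x = x \<bullet> p" "p \<bullet> x' = x' \<bullet> p" "x' \<bullet> x = x \<bullet> x'" "p \<bullet> p' = x' \<bullet> p"
    using comm_scalar_prod[OF c(1) x] comm_scalar_prod[OF c(1) x'] comm_scalar_prod[OF x' x]
      comm_scalar_prod[OF c(1) c(2)] pp by auto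
  have z: "z \<bullet> z = (1 + \<beta>)\<^sup>2 * (x \<bullet> x) + (\<omega>\<^sup>2 - 2 * \<omega> * (1 + \<beta>)) * (x \<bullet> p) + \<beta>\<^sup>2 * (x' \<bullet> x')
      - 2 * \<beta> * (1 + \<beta>) * (x \<bullet> x') + 2 * \<omega> * \<beta> * (x' \<bullet> p)"
    unfolding z_def p_def[symmetric] using x x' c
    by (simp add: scalar_prod_minus_distrib[of _ n] minus_scalar_prod_distrib[of _ n]
        scalar_prod_add_distrib[of _ n] add_scalar_prod_distrib[of _ n] comm pp power2_eq_square algebra_simps)
  have "0 \<le> (x + x') \<bullet> (x + x')" by (rule scalar_prod_self_nonneg)
  then have 1: "- 2 * (x \<bullet> x') \<le> x \<bullet> x + x' \<bullet> x'"
    using x x' by (simp add: scalar_prod_add_distrib[of _ n] add_scalar_prod_distrib[of _ n] comm)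
  have "0 \<le> (p - p') \<bullet> (p - p')" by (rule scalar_prod_self_nonneg)
  then have 2: "2 * (x' \<bullet> p) \<le> x \<bullet> p + x' \<bullet> p'"
    using c by (simp add: scalar_prod_minus_distrib[of _ n] minus_scalar_prod_distrib[of _ n] comm pp)
  have "\<beta> * (1 + \<beta>) * (- 2 * (x \<bullet> x')) \<le> \<beta> * (1 + \<beta>) * (x \<bullet> x + x' \<bullet> x')"
    using 1 \<beta> by (intro mult_left_mono) auto
  moreover have "\<omega> * \<beta> * (2 * (x' \<bullet> p)) \<le> \<omega> * \<beta> * (x \<bullet> p + x' \<bullet> p')"
    using 2 \<omega> \<beta> by (intro mult_left_mono) auto
  ultimately show ?thesis
    unfolding z p_def[symmetric] p'_def[symmetric] by (simp add: power2_eq_square algebra_simps)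
qed

text \<open>The iteration satisfied by \<open>L (y\<^sub>k - y\<^sub>*)\<close>, for one realization of the projections; the first
projection has index 1, as the first sketch does.\<close>

fun momentum_iter :: "real \<Rightarrow> real \<Rightarrow> real vec \<Rightarrow> (nat \<Rightarrow> real mat) \<Rightarrow> nat \<Rightarrow> real vec" where
  "momentum_iter \<omega> \<beta> v P 0 = v"
| "momentum_iter \<omega> \<beta> v P (Suc 0) = v"
| "momentum_iter \<omega> \<beta> v P (Suc (Suc k)) =
     (let x = momentum_iter \<omega> \<beta> v P (Suc k) in
      x - \<omega> \<cdot>\<^sub>v (P (Suc k) *\<^sub>v x) + \<beta> \<cdot>\<^sub>v (x - momentum_iter \<omega> \<beta> v P k))"

lemma dim_momentum_iter [simp]: "dim_vec (momentum_iter \<omega> \<beta> v P k) = dim_vec v"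
  by (induction \<omega> \<beta> v P k rule: momentum_iter.induct) (simp_all add: Let_def)

lemma momentum_iter_carrier: "v \<in> carrier_vec n \<Longrightarrow> momentum_iter \<omega> \<beta> v P k \<in> carrier_vec n"
  by (rule carrier_vecI) simp

lemma momentum_iter_cong:
  "(\<And>i. 1 \<le> i \<Longrightarrow> i < k \<Longrightarrow> P i = P' i) \<Longrightarrow> momentum_iter \<omega> \<beta> v P k = momentum_iter \<omega> \<beta> v P' k"
  by (induction \<omega> \<beta> v P k rule: momentum_iter.induct) (auto simp: Let_def)

text \<open>A bound uniform in the projections; it makes all products of iterate entries integrable.\<close>

lemma momentum_iter_bounded:
  assumes v: "v \<in> carrier_vec n" and \<omega>: "0 \<le> \<omega>" "\<omega> \<le> 2" and \<beta>: "0 \<le> \<beta>"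
  shows "\<exists>b. \<forall>P. (\<forall>i\<ge>1. orth_projection n (P i)) \<longrightarrow> momentum_iter \<omega> \<beta> v P k \<bullet> momentum_iter \<omega> \<beta> v P k \<le> b"
proof (induction k rule: less_induct)
  case (less k)
  show ?case
  proof (cases "k < 2")
    case True
    then have "momentum_iter \<omega> \<beta> v P k = v" for P by (cases k) (simp_all add: less_Suc_eq)
    then show ?thesis by (intro exI[of _ "v \<bullet> v"]) simp
  next
    case False
    define l where "l = k - 2"
    have k: "k = Suc (Suc l)" using False by (simp add: l_def)
    obtain b where b: "\<And>P. (\<forall>i\<ge>1. orth_projection n (P i)) \<Longrightarrow>
        momentum_iter \<omega> \<beta> v P (Suc l) \<bullet> momentum_iter \<omega> \<beta> v P (Suc l) \<le> b" using less[of "Suc l"] k by auto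
    obtain b' where b': "\<And>P. (\<forall>i\<ge>1. orth_projection n (P i)) \<Longrightarrow>
        momentum_iter \<omega> \<beta> v P l \<bullet> momentum_iter \<omega> \<beta> v P l \<le> b'" using less[of l] k by auto
    have "momentum_iter \<omega> \<beta> v P k \<bullet> momentum_iter \<omega> \<beta> v P k
        \<le> (1 + 3 * \<beta> + 2 * \<beta>\<^sup>2) * b + (\<beta> + 2 * \<beta>\<^sup>2) * b' + \<omega> * \<beta> * b'"
      if P: "\<forall>i\<ge>1. orth_projection n (P i)" for P
    proof -
      define x x' where "x = momentum_iter \<omega> \<beta> v P (Suc l)" and "x' = momentum_iter \<omega> \<beta> v P l"
      have c: "x \<in> carrier_vec n" "x' \<in> carrier_vec n" using momentum_iter_carrier[OF v] by (auto simp: x_def x'_def)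
      have Pl: "orth_projection n (P (Suc l))" using P by simp
      have "0 \<le> (\<omega> * (2 - \<omega>) + \<omega> * \<beta>) * (x \<bullet> (P (Suc l) *\<^sub>v x))"
        using orth_projection_nonneg[OF Pl c(1)] \<omega> \<beta> by simp
      moreover have "\<omega> * \<beta> * (x' \<bullet> (P (Suc l) *\<^sub>v x')) \<le> \<omega> * \<beta> * (x' \<bullet> x')"
        using orth_projection_le[OF Pl c(2)] \<omega> \<beta> by (intro mult_left_mono) auto
      moreover have "\<omega> * \<beta> * (x' \<bullet> x') \<le> \<omega> * \<beta> * b'"
        using b'[OF P] \<omega> \<beta> unfolding x'_def by (intro mult_left_mono) auto
      moreover have "(1 + 3 * \<beta> + 2 * \<beta>\<^sup>2) * (x \<bullet> x) \<le> (1 + 3 * \<beta> + 2 * \<beta>\<^sup>2) * b"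
        using b[OF P] \<beta> unfolding x_def by (intro mult_left_mono) auto
      moreover have "(\<beta> + 2 * \<beta>\<^sup>2) * (x' \<bullet> x') \<le> (\<beta> + 2 * \<beta>\<^sup>2) * b'"
        using b'[OF P] \<beta> unfolding x'_def by (intro mult_left_mono) auto
      ultimately show ?thesis
        using momentum_step_norm[OF Pl c \<omega>(1) \<beta>]
        unfolding k momentum_iter.simps Let_def x_def[symmetric] x'_def[symmetric] by linarith
    qed
    then show ?thesis by (intro exI allI impI)
  qed
qed

lemma abs_entry_le_norm:
  fixes x :: "real vec"
  assumes "x \<bullet> x \<le> b" "i < dim_vec x"
  shows "\<bar>x $ i\<bar> \<le> sqrt b"
proof -
  have "(x $ i)\<^sup>2 \<le> (\<Sum>i<dim_vec x. (x $ i)\<^sup>2)" using assms by (intro member_le_sum) auto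
  also have "\<dots> \<le> b" using assms by (simp add: scalar_prod_def atLeast0LessThan power2_eq_square)
  finally have "sqrt ((x $ i)\<^sup>2) \<le> sqrt b" by (rule real_sqrt_le_mono)
  then show ?thesis by simp
qed

section \<open>Expected decrease for independent random projections\<close>

lemma integrable_double_sum:
  fixes f :: "nat \<Rightarrow> nat \<Rightarrow> 'a \<Rightarrow> real"
  assumes "\<And>i j. i < n \<Longrightarrow> j < n \<Longrightarrow> integrable M (f i j)"
  shows "integrable M (\<lambda>w. \<Sum>i<n. \<Sum>j<n. f i j w)"
    and "(\<integral>w. (\<Sum>i<n. \<Sum>j<n. f i j w) \<partial>M) = (\<Sum>i<n. \<Sum>j<n. \<integral>w. f i j w \<partial>M)"
proof -
  show "integrable M (\<lambda>w. \<Sum>i<n. \<Sum>j<n. f i j w)"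
    using assms by (intro Bochner_Integration.integrable_sum) auto
  have "(\<integral>w. (\<Sum>i<n. \<Sum>j<n. f i j w) \<partial>M) = (\<Sum>i<n. \<integral>w. (\<Sum>j<n. f i j w) \<partial>M)"
    using assms by (intro Bochner_Integration.integral_sum Bochner_Integration.integrable_sum) auto
  also have "\<dots> = (\<Sum>i<n. \<Sum>j<n. \<integral>w. f i j w \<partial>M)"
    using assms by (intro sum.cong refl Bochner_Integration.integral_sum) auto
  finally show "(\<integral>w. (\<Sum>i<n. \<Sum>j<n. f i j w) \<partial>M) = (\<Sum>i<n. \<Sum>j<n. \<integral>w. f i j w \<partial>M)" .
qed

text \<open>The random parameter \<open>X k\<close> stands for the sketch. Keeping it abstract separates the probabilistic
argument, which only sees bounded measurable projections, from the linear system.\<close>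

locale random_projections = prob_space M
  for M :: "'w measure" +
  fixes N D :: "'s measure" and X :: "nat \<Rightarrow> 'w \<Rightarrow> 's" and P :: "'s \<Rightarrow> real mat"
    and n :: nat and v :: "real vec" and \<omega> \<beta> :: real
  assumes indep: "indep_vars (\<lambda>_. N) X {1..}"
    and distr: "\<And>k. 1 \<le> k \<Longrightarrow> distr M N (X k) = D"
    and proj: "\<And>s. s \<in> space N \<Longrightarrow> orth_projection n (P s)"
    and meas: "\<And>i j. i < n \<Longrightarrow> j < n \<Longrightarrow> (\<lambda>s. P s $$ (i, j)) \<in> borel_measurable N"
    and bound: "\<And>s i j. s \<in> space N \<Longrightarrow> i < n \<Longrightarrow> j < n \<Longrightarrow> \<bar>P s $$ (i, j)\<bar> \<le> 1"
    and v: "v \<in> carrier_vec n" and \<omega>: "0 \<le> \<omega>" "\<omega> \<le> 2" and \<beta>: "0 \<le> \<beta>"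
begin

definition mean_proj :: "real mat" where
  "mean_proj = Matrix.mat n n (\<lambda>(i, j). \<integral>s. P s $$ (i, j) \<partial>D)"

definition iter :: "nat \<Rightarrow> 'w \<Rightarrow> real vec" where
  "iter k w = momentum_iter \<omega> \<beta> v (\<lambda>i. P (X i w)) k"

lemma X_measurable: "1 \<le> i \<Longrightarrow> X i \<in> measurable M N"
  using indep by (auto simp: indep_vars_def)

lemma X_space: "1 \<le> i \<Longrightarrow> w \<in> space M \<Longrightarrow> X i w \<in> space N"
  using X_measurable by (meson measurable_space)

lemma P_carrier: "s \<in> space N \<Longrightarrow> P s \<in> carrier_mat n n"
  using proj by (simp add: orth_projection_def)

lemma iter_carrier: "iter k w \<in> carrier_vec n"
  unfolding iter_def by (rule momentum_iter_carrier[OF v])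

lemma dim_iter [simp]: "dim_vec (iter k w) = n"
  using iter_carrier by (rule carrier_vecD)

text \<open>The index set \<open>J\<close> is kept variable because the two preceding iterates in the recursion involve different sets of
indices.\<close>

lemma borel_measurable_momentum_entry:
  assumes "{1..<k} \<subseteq> J" "j < n"
  shows "(\<lambda>s. momentum_iter \<omega> \<beta> v (\<lambda>i. P (s i)) k $ j) \<in> borel_measurable (PiM J (\<lambda>_. N))"
  using assms
proof (induction k arbitrary: j rule: less_induct)
  case (less k)
  consider "k = 0" | "k = Suc 0" | l where "k = Suc (Suc l)" by (metis not0_implies_Suc)
  then show ?case
  proof cases
    case (3 l)
    define x where "x l s = momentum_iter \<omega> \<beta> v (\<lambda>i. P (s i)) l" for l and s :: "nat \<Rightarrow> 's"
    have xm: "(\<lambda>s. x l' s $ i) \<in> borel_measurable (PiM J (\<lambda>_. N))" if "l' < k" "i < n" for l' i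
    proof -
      have "{1..<l'} \<subseteq> {1..<k}" using that by (intro ivl_subset[THEN iffD2]) simp
      then show ?thesis unfolding x_def using less.IH that less.prems(1) by blast
    qed
    have lJ: "Suc l \<in> J" using less.prems 3 by auto
    have Pm: "(\<lambda>s. P (s (Suc l)) $$ (i, i')) \<in> borel_measurable (PiM J (\<lambda>_. N))" if "i < n" "i' < n" for i i'
      using measurable_compose[OF measurable_component_singleton[OF lJ] meas[OF that]] .
    have "(\<lambda>s. x (Suc l) s $ j - \<omega> * (\<Sum>i<n. P (s (Suc l)) $$ (j, i) * x (Suc l) s $ i) + \<beta> * (x (Suc l) s $ j - x l s $ j))
        \<in> borel_measurable (PiM J (\<lambda>_. N))"
      using less.prems 3
      by (intro borel_measurable_add borel_measurable_diff borel_measurable_times borel_measurable_const borel_measurable_sum xm Pm) auto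
    moreover have "x k s $ j = x (Suc l) s $ j - \<omega> * (\<Sum>i<n. P (s (Suc l)) $$ (j, i) * x (Suc l) s $ i)
        + \<beta> * (x (Suc l) s $ j - x l s $ j)" if "s \<in> space (PiM J (\<lambda>_. N))" for s
    proof -
      have "s (Suc l) \<in> space N" using that lJ by (auto simp: space_PiM)
      from carrier_matD[OF P_carrier[OF this]] carrier_vecD[OF v] less.prems(2)
      show ?thesis by (simp add: x_def 3 Let_def scalar_prod_def atLeast0LessThan)
    qed
    ultimately show ?thesis unfolding x_def[symmetric] by (subst measurable_cong) auto
  qed simp_all
qed

lemma iter_restrict:
  assumes "{1..<k} \<subseteq> J"
  shows "iter k w = momentum_iter \<omega> \<beta> v (\<lambda>i. P (restrict (\<lambda>i. X i w) J i)) k"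
  unfolding iter_def using assms by (intro momentum_iter_cong) (auto simp: subset_iff)

lemma iter_entry_measurable:
  assumes "j < n"
  shows "(\<lambda>w. iter k w $ j) \<in> borel_measurable M"
proof -
  have "(\<lambda>w. restrict (\<lambda>i. X i w) {1..<k}) \<in> measurable M (PiM {1..<k} (\<lambda>_. N))"
    by (intro measurable_restrict X_measurable) auto
  from measurable_compose[OF this borel_measurable_momentum_entry[OF subset_refl assms]]
  show ?thesis by (simp add: iter_restrict[OF subset_refl])
qed

lemma iter_bounded:
  obtains b where "\<And>w j. w \<in> space M \<Longrightarrow> j < n \<Longrightarrow> \<bar>iter k w $ j\<bar> \<le> b"
proof -
  obtain b where b: "\<And>Q. (\<forall>i\<ge>1. orth_projection n (Q i)) \<Longrightarrow>
      momentum_iter \<omega> \<beta> v Q k \<bullet> momentum_iter \<omega> \<beta> v Q k \<le> b"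
    using momentum_iter_bounded[OF v \<omega> \<beta>, of k] by blast
  have "\<bar>iter k w $ j\<bar> \<le> sqrt b" if "w \<in> space M" "j < n" for w j
    using that b[of "\<lambda>i. P (X i w)"] proj X_space by (intro abs_entry_le_norm) (auto simp: iter_def[symmetric])
  then show ?thesis by (rule that)
qed

lemma iter_product_integrable:
  assumes "i < n" "j < n"
  shows "integrable M (\<lambda>w. iter k w $ i * iter k w $ j)"
proof -
  obtain b where b: "\<And>w j. w \<in> space M \<Longrightarrow> j < n \<Longrightarrow> \<bar>iter k w $ j\<bar> \<le> b" using iter_bounded[of k] by blast
  show ?thesis
  proof (rule integrable_const_bound[where B = "b * b"])
    show "AE w in M. norm (iter k w $ i * iter k w $ j) \<le> b * b"
    proof (rule AE_I2)
      fix w assume "w \<in> space M"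
      then have "\<bar>iter k w $ i\<bar> \<le> b" "\<bar>iter k w $ j\<bar> \<le> b" using b assms by auto
      then show "norm (iter k w $ i * iter k w $ j) \<le> b * b"
        by (auto simp: abs_mult intro!: mult_mono)
    qed
    show "(\<lambda>w. iter k w $ i * iter k w $ j) \<in> borel_measurable M"
      using iter_entry_measurable assms by (intro borel_measurable_times)
  qed
qed

lemma iter_norm_integrable: "integrable M (\<lambda>w. iter k w \<bullet> iter k w)"
  unfolding scalar_prod_def dim_iter
  by (intro Bochner_Integration.integrable_sum iter_product_integrable) simp_all

text \<open>The iterate with index \<open>k \<le> l + 1\<close> is a function of \<open>X 1, \<dots>, X l\<close>, hence independent of \<open>X (l + 1)\<close>.\<close>

lemma iter_proj_factor:
  assumes k: "k \<le> Suc l" and ij: "i < n" "j < n"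
  shows "integrable M (\<lambda>w. (iter k w $ i * iter k w $ j) * P (X (Suc l) w) $$ (i, j))"
    and "(\<integral>w. (iter k w $ i * iter k w $ j) * P (X (Suc l) w) $$ (i, j) \<partial>M)
       = (\<integral>w. iter k w $ i * iter k w $ j \<partial>M) * mean_proj $$ (i, j)"
proof -
  let ?A = "{1..<Suc l}" and ?B = "{Suc l}"
  define g where "g s = momentum_iter \<omega> \<beta> v (\<lambda>i. P (s i)) k $ i * momentum_iter \<omega> \<beta> v (\<lambda>i. P (s i)) k $ j" for s :: "nat \<Rightarrow> 's"
  define h where "h s = P (s (Suc l)) $$ (i, j)" for s :: "nat \<Rightarrow> 's"
  have sub: "{1..<k} \<subseteq> ?A" using k by auto
  have "indep_var (PiM ?A (\<lambda>_. N)) (\<lambda>w. restrict (\<lambda>i. X i w) ?A) (PiM ?B (\<lambda>_. N)) (\<lambda>w. restrict (\<lambda>i. X i w) ?B)"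
    by (rule indep_var_restrict[OF indep]) auto
  moreover have "g \<in> borel_measurable (PiM ?A (\<lambda>_. N))"
    unfolding g_def using sub ij by (intro borel_measurable_times borel_measurable_momentum_entry)
  moreover have "h \<in> borel_measurable (PiM ?B (\<lambda>_. N))"
    unfolding h_def
    by (rule measurable_compose[OF _ meas[OF ij]], rule measurable_component_singleton) simp
  ultimately have ind: "indep_var borel (g \<circ> (\<lambda>w. restrict (\<lambda>i. X i w) ?A)) borel (h \<circ> (\<lambda>w. restrict (\<lambda>i. X i w) ?B))"
    by (rule indep_var_compose)
  have g: "g \<circ> (\<lambda>w. restrict (\<lambda>i. X i w) ?A) = (\<lambda>w. iter k w $ i * iter k w $ j)"
    by (simp add: fun_eq_iff g_def iter_restrict[OF sub])
  have h: "h \<circ> (\<lambda>w. restrict (\<lambda>i. X i w) ?B) = (\<lambda>w. P (X (Suc l) w) $$ (i, j))"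
    by (simp add: fun_eq_iff h_def)
  have Pm: "(\<lambda>w. P (X (Suc l) w) $$ (i, j)) \<in> borel_measurable M"
    by (rule measurable_compose[OF X_measurable meas[OF ij]]) simp
  have Pi: "integrable M (\<lambda>w. P (X (Suc l) w) $$ (i, j))"
    by (rule integrable_const_bound[where B = 1, OF AE_I2 Pm]) (use bound X_space ij in auto)
  have "(\<integral>w. P (X (Suc l) w) $$ (i, j) \<partial>M) = (\<integral>s. P s $$ (i, j) \<partial>(distr M N (X (Suc l))))"
    by (rule integral_distr[symmetric, OF X_measurable meas[OF ij]]) simp
  then have E: "(\<integral>w. P (X (Suc l) w) $$ (i, j) \<partial>M) = mean_proj $$ (i, j)"
    using ij by (simp add: distr mean_proj_def)
  show "integrable M (\<lambda>w. (iter k w $ i * iter k w $ j) * P (X (Suc l) w) $$ (i, j))"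
    using indep_var_integrable[OF ind[unfolded g h] iter_product_integrable[OF ij] Pi] .
  show "(\<integral>w. (iter k w $ i * iter k w $ j) * P (X (Suc l) w) $$ (i, j) \<partial>M)
       = (\<integral>w. iter k w $ i * iter k w $ j \<partial>M) * mean_proj $$ (i, j)"
    using indep_var_lebesgue_integral[OF ind[unfolded g h] iter_product_integrable[OF ij] Pi] E by simp
qed

lemma mean_proj_carrier: "mean_proj \<in> carrier_mat n n"
  by (simp add: mean_proj_def)

lemma iter_mean_integrable: "integrable M (\<lambda>w. iter k w \<bullet> (mean_proj *\<^sub>v iter k w))"
  unfolding quadratic_form_sum[OF mean_proj_carrier iter_carrier]
  by (intro integrable_double_sum(1) integrable_mult_left iter_product_integrable)

text \<open>A quadratic form is linear in the products of the entries, so independence applies term by term. It is needed for both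
\<open>k = l + 1\<close> and \<open>k = l\<close>, the two iterates that enter one step.\<close>

lemma expected_proj_quadratic_form:
  assumes "k \<le> Suc l"
  shows "integrable M (\<lambda>w. iter k w \<bullet> (P (X (Suc l) w) *\<^sub>v iter k w))"
    and "(\<integral>w. iter k w \<bullet> (P (X (Suc l) w) *\<^sub>v iter k w) \<partial>M) = (\<integral>w. iter k w \<bullet> (mean_proj *\<^sub>v iter k w) \<partial>M)"
proof -
  let ?f = "\<lambda>w. \<Sum>i<n. \<Sum>j<n. (iter k w $ i * iter k w $ j) * P (X (Suc l) w) $$ (i, j)"
  have eq: "iter k w \<bullet> (P (X (Suc l) w) *\<^sub>v iter k w) = ?f w" if "w \<in> space M" for w
    by (rule quadratic_form_sum[OF P_carrier[OF X_space[OF _ that]] iter_carrier]) simp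
  have int: "integrable M ?f"
    by (intro integrable_double_sum(1) iter_proj_factor(1)[OF assms])
  show "integrable M (\<lambda>w. iter k w \<bullet> (P (X (Suc l) w) *\<^sub>v iter k w))"
    by (rule Bochner_Integration.integrable_cong[THEN iffD2, OF refl eq int]) simp_all
  have "(\<integral>w. iter k w \<bullet> (P (X (Suc l) w) *\<^sub>v iter k w) \<partial>M) = (\<integral>w. ?f w \<partial>M)"
    by (rule Bochner_Integration.integral_cong[OF refl eq])
  also have "\<dots> = (\<Sum>i<n. \<Sum>j<n. (\<integral>w. iter k w $ i * iter k w $ j \<partial>M) * mean_proj $$ (i, j))"
    by (subst integrable_double_sum(2)) (simp_all add: iter_proj_factor[OF assms])
  also have "\<dots> = (\<integral>w. (\<Sum>i<n. \<Sum>j<n. (iter k w $ i * iter k w $ j) * mean_proj $$ (i, j)) \<partial>M)"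
    by (subst integrable_double_sum(2)) (simp_all add: iter_product_integrable)
  finally show "(\<integral>w. iter k w \<bullet> (P (X (Suc l) w) *\<^sub>v iter k w) \<partial>M) = (\<integral>w. iter k w \<bullet> (mean_proj *\<^sub>v iter k w) \<partial>M)"
    unfolding quadratic_form_sum[OF mean_proj_carrier iter_carrier] .
qed

text \<open>The lower bound for the mean projection is only assumed along the iterates: on the whole space it fails
as soon as the mean projection is singular and \<open>lmin\<close> is positive.\<close>

theorem expected_norm_recursion:
  fixes lmin lmax :: real
  assumes lower: "\<And>k w. w \<in> space M \<Longrightarrow> lmin * (iter k w \<bullet> iter k w) \<le> iter k w \<bullet> (mean_proj *\<^sub>v iter k w)"
    and upper: "\<And>x. x \<in> carrier_vec n \<Longrightarrow> x \<bullet> (mean_proj *\<^sub>v x) \<le> lmax * (x \<bullet> x)"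
  shows "expectation (\<lambda>w. iter (k + 2) w \<bullet> iter (k + 2) w)
    \<le> (1 + 3 * \<beta> + 2 * \<beta>\<^sup>2 - (\<omega> * (2 - \<omega>) + \<omega> * \<beta>) * lmin) * expectation (\<lambda>w. iter (k + 1) w \<bullet> iter (k + 1) w)
      + (\<beta> + 2 * \<beta>\<^sup>2 + \<omega> * \<beta> * lmax) * expectation (\<lambda>w. iter k w \<bullet> iter k w)"
proof -
  let ?F = "\<lambda>k. expectation (\<lambda>w. iter k w \<bullet> iter k w)"
  let ?G = "\<lambda>k. expectation (\<lambda>w. iter k w \<bullet> (mean_proj *\<^sub>v iter k w))"
  let ?P = "\<lambda>w. P (X (Suc k) w)"
  let ?R = "\<lambda>w. (1 + 3 * \<beta> + 2 * \<beta>\<^sup>2) * (iter (Suc k) w \<bullet> iter (Suc k) w)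
     - (\<omega> * (2 - \<omega>) + \<omega> * \<beta>) * (iter (Suc k) w \<bullet> (?P w *\<^sub>v iter (Suc k) w))
     + (\<beta> + 2 * \<beta>\<^sup>2) * (iter k w \<bullet> iter k w) + \<omega> * \<beta> * (iter k w \<bullet> (?P w *\<^sub>v iter k w))"
  note int = iter_norm_integrable expected_proj_quadratic_form(1)[of "Suc k" k] expected_proj_quadratic_form(1)[of k k]
  have "?F (k + 2) \<le> expectation ?R"
  proof (rule integral_mono[OF iter_norm_integrable])
    show "integrable M ?R" using int by simp
    fix w assume w: "w \<in> space M"
    have "iter (k + 2) w = iter (Suc k) w - \<omega> \<cdot>\<^sub>v (?P w *\<^sub>v iter (Suc k) w) + \<beta> \<cdot>\<^sub>v (iter (Suc k) w - iter k w)"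
      by (simp add: iter_def Let_def)
    then show "iter (k + 2) w \<bullet> iter (k + 2) w \<le> ?R w"
      using momentum_step_norm[OF proj[OF X_space[OF _ w]] iter_carrier iter_carrier \<omega>(1) \<beta>, of "Suc k" "Suc k" w k w] by simp
  qed
  also have "expectation ?R = (1 + 3 * \<beta> + 2 * \<beta>\<^sup>2) * ?F (Suc k) - (\<omega> * (2 - \<omega>) + \<omega> * \<beta>) * ?G (Suc k)
      + (\<beta> + 2 * \<beta>\<^sup>2) * ?F k + \<omega> * \<beta> * ?G k"
    using int expected_proj_quadratic_form(2)[of "Suc k" k] expected_proj_quadratic_form(2)[of k k] by simp
  finally have main: "?F (k + 2) \<le> \<dots>" .
  have "lmin * ?F (Suc k) = expectation (\<lambda>w. lmin * (iter (Suc k) w \<bullet> iter (Suc k) w))" by simp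
  also have "\<dots> \<le> ?G (Suc k)"
    using iter_norm_integrable iter_mean_integrable lower by (intro integral_mono) auto
  finally have "(\<omega> * (2 - \<omega>) + \<omega> * \<beta>) * (lmin * ?F (Suc k)) \<le> (\<omega> * (2 - \<omega>) + \<omega> * \<beta>) * ?G (Suc k)"
    using \<omega> \<beta> by (intro mult_left_mono) auto
  moreover have "?G k \<le> expectation (\<lambda>w. lmax * (iter k w \<bullet> iter k w))"
    using iter_norm_integrable iter_mean_integrable upper iter_carrier by (intro integral_mono) auto
  then have "\<omega> * \<beta> * ?G k \<le> \<omega> * \<beta> * (lmax * ?F k)" using \<omega> \<beta> by (intro mult_left_mono) auto
  ultimately show ?thesis using main by (simp add: algebra_simps)
qed

end

section \<open>The mean projection\<close>

lemma mult_mat3_index: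
  fixes U F V :: "real mat"
  assumes "U \<in> carrier_mat n n" "F \<in> carrier_mat n n" "V \<in> carrier_mat n n" "i < n" "j < n"
  shows "(U * F * V) $$ (i, j) = (\<Sum>k<n. \<Sum>l<n. (U $$ (i, k) * V $$ (l, j)) * F $$ (k, l))"
  using assms by (simp add: scalar_prod_def atLeast0LessThan sum_distrib_left sum_distrib_right ac_simps)

text \<open>Expectation commutes with multiplication by constant matrices on both sides. It is applied once to
express \<open>Z\<close> by the projection and once to pass from the mean of \<open>Z\<close> to \<open>W\<close>.\<close>

lemma expectation_mult_mat3:
  fixes U V :: "real mat" and F :: "'s \<Rightarrow> real mat"
  assumes U: "U \<in> carrier_mat n n" and V: "V \<in> carrier_mat n n"
    and F: "\<And>s. s \<in> space D \<Longrightarrow> F s \<in> carrier_mat n n"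
    and int: "\<And>i j. i < n \<Longrightarrow> j < n \<Longrightarrow> integrable D (\<lambda>s. F s $$ (i, j))"
    and ij: "i < n" "j < n"
  shows "integrable D (\<lambda>s. (U * F s * V) $$ (i, j))"
    and "(\<integral>s. (U * F s * V) $$ (i, j) \<partial>D) = (U * Matrix.mat n n (\<lambda>(i, j). \<integral>s. F s $$ (i, j) \<partial>D) * V) $$ (i, j)"
proof -
  let ?f = "\<lambda>s. \<Sum>k<n. \<Sum>l<n. (U $$ (i, k) * V $$ (l, j)) * F s $$ (k, l)"
  have eq: "(U * F s * V) $$ (i, j) = ?f s" if "s \<in> space D" for s
    by (rule mult_mat3_index[OF U F[OF that] V ij])
  have inti: "integrable D ?f"
    by (intro integrable_double_sum(1) integrable_mult_right int)
  show "integrable D (\<lambda>s. (U * F s * V) $$ (i, j))"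
    by (rule Bochner_Integration.integrable_cong[THEN iffD2, OF refl eq inti]) simp_all
  have "(\<integral>s. (U * F s * V) $$ (i, j) \<partial>D) = (\<integral>s. ?f s \<partial>D)"
    by (rule Bochner_Integration.integral_cong[OF refl eq])
  also have "\<dots> = (\<Sum>k<n. \<Sum>l<n. \<integral>s. (U $$ (i, k) * V $$ (l, j)) * F s $$ (k, l) \<partial>D)"
    by (intro integrable_double_sum(2) integrable_mult_right int)
  also have "\<dots> = (U * Matrix.mat n n (\<lambda>(i, j). \<integral>s. F s $$ (i, j) \<partial>D) * V) $$ (i, j)"
    by (subst mult_mat3_index[OF U mat_carrier V ij]) simp
  finally show "(\<integral>s. (U * F s * V) $$ (i, j) \<partial>D) = (U * Matrix.mat n n (\<lambda>(i, j). \<integral>s. F s $$ (i, j) \<partial>D) * V) $$ (i, j)" .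
qed

context random_projections
begin

lemma D_eq: "D = distr M N (X 1)"
  using distr[of 1] by simp

lemma space_D: "space D = space N"
  by (simp add: D_eq)

lemma D_entry_integrable:
  assumes "i < n" "j < n"
  shows "integrable D (\<lambda>s. P s $$ (i, j))"
proof -
  interpret D: prob_space D unfolding D_eq by (rule prob_space_distr) (rule X_measurable, simp)
  have "(\<lambda>s. P s $$ (i, j)) \<in> borel_measurable D"
    using meas[OF assms] by (simp add: D_eq)
  then show ?thesis
    using bound assms by (intro D.integrable_const_bound[where B = 1, OF AE_I2]) (auto simp: space_D)
qed

lemma mean_proj_transpose: "mean_proj\<^sup>T = mean_proj"
proof (rule eq_matI)
  fix i j assume "i < dim_row mean_proj" "j < dim_col mean_proj"
  then have ij: "i < n" "j < n" by (auto simp: mean_proj_def)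
  have "P s $$ (j, i) = P s $$ (i, j)" if "s \<in> space D" for s
    using that ij proj[of s] unfolding space_D orth_projection_def
    by (metis carrier_matD index_transpose_mat(1))
  then have "(\<integral>s. P s $$ (j, i) \<partial>D) = (\<integral>s. P s $$ (i, j) \<partial>D)"
    by (rule Bochner_Integration.integral_cong[OF refl])
  then show "mean_proj\<^sup>T $$ (i, j) = mean_proj $$ (i, j)" using ij by (simp add: mean_proj_def)
qed (simp_all add: mean_proj_def)

lemma mean_proj_quadratic_form:
  assumes x: "x \<in> carrier_vec n"
  shows "x \<bullet> (mean_proj *\<^sub>v x) = (\<integral>s. x \<bullet> (P s *\<^sub>v x) \<partial>D)"
proof -
  have "(\<integral>s. x \<bullet> (P s *\<^sub>v x) \<partial>D) = (\<integral>s. (\<Sum>i<n. \<Sum>j<n. (x $ i * x $ j) * P s $$ (i, j)) \<partial>D)"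
    by (rule Bochner_Integration.integral_cong[OF refl quadratic_form_sum[OF _ x]])
      (simp add: space_D P_carrier)
  also have "\<dots> = (\<Sum>i<n. \<Sum>j<n. \<integral>s. (x $ i * x $ j) * P s $$ (i, j) \<partial>D)"
    by (intro integrable_double_sum(2) integrable_mult_right D_entry_integrable)
  finally show ?thesis
    unfolding quadratic_form_sum[OF mean_proj_carrier x] by (simp add: mean_proj_def)
qed

lemma mean_proj_nonneg:
  assumes "x \<in> carrier_vec n"
  shows "0 \<le> x \<bullet> (mean_proj *\<^sub>v x)"
  unfolding mean_proj_quadratic_form[OF assms]
  by (rule Bochner_Integration.integral_nonneg_AE[OF AE_I2])
    (simp add: space_D orth_projection_nonneg[OF proj assms])

text \<open>For \<open>n = 0\<close> the maximum would range over an empty set of eigenvalues.\<close>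

lemma mean_proj_lambda_max_nonneg:
  assumes "0 < n"
  shows "0 \<le> lambda_max mean_proj"
proof -
  have e: "unit_vec n 0 \<in> carrier_vec n" "unit_vec n 0 \<bullet> unit_vec n 0 = (1 :: real)"
    using assms by simp_all
  show ?thesis
    using rayleigh_le_lambda_max[OF mean_proj_carrier mean_proj_transpose e(1)] mean_proj_nonneg[OF e(1)]
    unfolding e(2) by linarith
qed

end

section \<open>The dual problem in projected coordinates\<close>

text \<open>The matrix \<open>L\<close> below satisfies \<open>L\<^sup>T L = A B\<^sup>-\<^sup>1 A\<^sup>T\<close>, the matrix of the quadratic part of the dual
objective.\<close>

locale dual_system =
  fixes A B :: "real mat" and b x0 :: "real vec" and m n :: nat
  assumes A: "A \<in> carrier_mat m n" and B: "spd_mat n B"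
    and b: "b \<in> carrier_vec m" and x0: "x0 \<in> carrier_vec n"
begin

definition "R = mat_sqrt (mat_inv B)"
definition "L = R * A\<^sup>T"

lemma R_carrier: "R \<in> carrier_mat n n" "R\<^sup>T = R" "R * R = mat_inv B"
  using mat_sqrt_spd[OF spd_mat_inv(1)[OF B]] by (auto simp: spd_mat_def R_def)

lemma dims_B: "dim_row B = n" "dim_col B = n" "dim_row (mat_inv B) = n" "dim_col (mat_inv B) = n"
  using B spd_mat_inv(1)[OF B] by (auto simp: spd_mat_def)

lemma dims [simp]:
  "dim_row A = m" "dim_col A = n" "dim_row B = n" "dim_col B = n" "dim_row R = n" "dim_col R = n"
  "dim_row (mat_inv B) = n" "dim_col (mat_inv B) = n" "dim_row L = n" "dim_col L = m"
  "dim_vec b = m" "dim_vec x0 = n"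
  using carrier_matD[OF A] carrier_matD[OF R_carrier(1)] dims_B carrier_vecD[OF b] carrier_vecD[OF x0]
  by (simp_all add: L_def)

lemma L_carrier: "L \<in> carrier_mat n m" by (rule carrier_matI) simp_all

lemma L_transpose: "L\<^sup>T = A * R"
  using R_carrier(2) by (simp add: L_def mat_dims)

lemma L_gram: "L\<^sup>T * L = A * mat_inv B * A\<^sup>T"
proof -
  have "L\<^sup>T * L = A * (R * R) * A\<^sup>T" unfolding L_transpose by (simp add: L_def mat_dims)
  then show ?thesis unfolding R_carrier(3) .
qed

lemma B_R_R: "B * R * R = 1\<^sub>m n" "R * R * B = 1\<^sub>m n" "R * B * R = 1\<^sub>m n"
proof -
  show 1: "B * R * R = 1\<^sub>m n"
    using spd_mat_inv(2)[OF B] R_carrier(3) by (simp add: mult_assoc_dim)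
  show "R * R * B = 1\<^sub>m n"
    using spd_mat_inv(3)[OF B] R_carrier(3) by simp
  show "R * B * R = 1\<^sub>m n"
    using mat_mult_left_right_inverse[OF _ R_carrier(1) 1] by (simp add: mult_assoc_dim carrier_matI)
qed

lemma mat_norm_dual:
  assumes "z \<in> carrier_vec m"
  shows "(mat_norm (mat_inv B) (A\<^sup>T *\<^sub>v z))\<^sup>2 = (L *\<^sub>v z) \<bullet> (L *\<^sub>v z)"
proof -
  have d: "dim_vec z = m" using assms by simp
  have "(A\<^sup>T *\<^sub>v z) \<bullet> (mat_inv B *\<^sub>v (A\<^sup>T *\<^sub>v z)) = (A\<^sup>T *\<^sub>v z) \<bullet> (R *\<^sub>v (R *\<^sub>v (A\<^sup>T *\<^sub>v z)))"
    unfolding R_carrier(3)[symmetric] using d by (simp add: mult_vec_assoc_dim)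
  also have "\<dots> = (R *\<^sub>v (A\<^sup>T *\<^sub>v z)) \<bullet> (R *\<^sub>v (A\<^sup>T *\<^sub>v z))"
    using d scalar_prod_mult_vec[of R "A\<^sup>T *\<^sub>v z" "R *\<^sub>v (A\<^sup>T *\<^sub>v z)"] R_carrier(2) by simp
  also have "R *\<^sub>v (A\<^sup>T *\<^sub>v z) = L *\<^sub>v z"
    using d by (simp add: L_def mult_vec_assoc_dim)
  finally show ?thesis
    using scalar_prod_self_nonneg[of "L *\<^sub>v z"] by (simp add: mat_norm_def)
qed

text \<open>Exact second-order expansion of the dual objective: the vector in front of \<open>u\<close> is its gradient at \<open>z\<close>.\<close>

lemma dual_obj_shift:
  assumes z: "z \<in> carrier_vec m" and u: "u \<in> carrier_vec m"
  shows "dual_obj A B b x0 (z + u) = dual_obj A B b x0 z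
     + (b - A *\<^sub>v x0 - L\<^sup>T *\<^sub>v (L *\<^sub>v z)) \<bullet> u - 1 / 2 * ((L *\<^sub>v u) \<bullet> (L *\<^sub>v u))"
proof -
  define g where "g = b - A *\<^sub>v x0"
  have Ax0: "A *\<^sub>v x0 \<in> carrier_vec m" using A x0 by simp
  have g: "g \<in> carrier_vec m" using b Ax0 by (simp add: g_def)
  have Lz: "L *\<^sub>v z \<in> carrier_vec n" "L *\<^sub>v u \<in> carrier_vec n" "L\<^sup>T *\<^sub>v (L *\<^sub>v z) \<in> carrier_vec m"
    using L_carrier z u by auto
  have "(L *\<^sub>v z) \<bullet> (L *\<^sub>v u) = (L\<^sup>T *\<^sub>v (L *\<^sub>v z)) \<bullet> u"
    using z u by (intro scalar_prod_mult_vec) auto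
  moreover have "L *\<^sub>v (z + u) = L *\<^sub>v z + L *\<^sub>v u"
    using L_carrier z u by (rule mult_add_distrib_mat_vec)
  ultimately show ?thesis
    unfolding dual_obj_def mat_norm_dual[OF z] mat_norm_dual[OF add_carrier_vec[OF z u]] g_def[symmetric]
    using g z u Lz comm_scalar_prod[OF Lz(1) Lz(2)]
    by (simp add: scalar_prod_add_distrib[of _ n] scalar_prod_add_distrib[of _ m] add_scalar_prod_distrib[of _ n]
        minus_scalar_prod_distrib[of _ m] algebra_simps)
qed

end

locale dual_optimum = dual_system +
  fixes ystar :: "real vec"
  assumes ystar: "ystar \<in> carrier_vec m"
    and opt: "\<And>z. z \<in> carrier_vec m \<Longrightarrow> dual_obj A B b x0 z \<le> dual_obj A B b x0 ystar"
begin

lemma stationary: "L\<^sup>T *\<^sub>v (L *\<^sub>v ystar) = b - A *\<^sub>v x0"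
proof -
  define g where "g = b - A *\<^sub>v x0 - L\<^sup>T *\<^sub>v (L *\<^sub>v ystar)"
  have c: "b - A *\<^sub>v x0 \<in> carrier_vec m" "L\<^sup>T *\<^sub>v (L *\<^sub>v ystar) \<in> carrier_vec m"
    by (auto intro!: carrier_vecI)
  have g: "g \<in> carrier_vec m" unfolding g_def using c by simp
  have Lg: "L *\<^sub>v g \<in> carrier_vec n" using L_carrier g by simp
  have "t * (g \<bullet> g) + t\<^sup>2 * (- 1 / 2 * ((L *\<^sub>v g) \<bullet> (L *\<^sub>v g))) \<le> 0" for t
  proof -
    have tg: "t \<cdot>\<^sub>v g \<in> carrier_vec m" using g by simp
    have "L *\<^sub>v (t \<cdot>\<^sub>v g) = t \<cdot>\<^sub>v (L *\<^sub>v g)" using L_carrier g by (rule mult_mat_vec)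
    then show ?thesis
      using dual_obj_shift[OF ystar tg] opt[OF add_carrier_vec[OF ystar tg]] g Lg
      by (simp add: g_def[symmetric] power2_eq_square)
  qed
  then have "g \<bullet> g = 0" by (rule quadratic_nonpos_imp_linear_coeff_0)
  then have g0: "g = 0\<^sub>v m" using scalar_prod_self_eq_0[OF g] by simp
  show ?thesis
  proof (rule eq_vecI)
    fix i assume i: "i < dim_vec (b - A *\<^sub>v x0)"
    then have "g $ i = 0" unfolding g0 by simp
    then show "(L\<^sup>T *\<^sub>v (L *\<^sub>v ystar)) $ i = (b - A *\<^sub>v x0) $ i"
      using i c unfolding g_def by (simp del: index_mult_mat_vec)
  qed simp
qed

lemma dual_gap:
  assumes y: "y \<in> carrier_vec m"
  shows "dual_obj A B b x0 ystar - dual_obj A B b x0 y = 1 / 2 * ((L *\<^sub>v (y - ystar)) \<bullet> (L *\<^sub>v (y - ystar)))"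
proof -
  have c: "b - A *\<^sub>v x0 \<in> carrier_vec m" by (auto intro!: carrier_vecI)
  have "ystar + (y - ystar) = y" using y ystar by (intro eq_vecI) auto
  moreover have "b - A *\<^sub>v x0 - L\<^sup>T *\<^sub>v (L *\<^sub>v ystar) = 0\<^sub>v m" unfolding stationary using c by simp
  ultimately show ?thesis
    using dual_obj_shift[OF ystar, of "y - ystar"] y ystar by simp
qed

text \<open>By stationarity, \<open>b - A x\<^sub>0\<close> is \<open>L\<^sup>T L y\<^sub>*\<close>, so the residual that drives the algorithm depends on \<open>y\<close>
only through \<open>L (y - y\<^sub>*)\<close>.\<close>

lemma dual_residual:
  assumes y: "y \<in> carrier_vec m"
  shows "b - A *\<^sub>v (x0 + mat_inv B *\<^sub>v (A\<^sup>T *\<^sub>v y)) = - (L\<^sup>T *\<^sub>v (L *\<^sub>v (y - ystar)))"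
proof -
  have d: "dim_vec y = m" "dim_vec ystar = m" using y ystar by auto
  have c: "L\<^sup>T *\<^sub>v (L *\<^sub>v y) \<in> carrier_vec m" "L\<^sup>T *\<^sub>v (L *\<^sub>v ystar) \<in> carrier_vec m"
    "L *\<^sub>v y \<in> carrier_vec n" "L *\<^sub>v ystar \<in> carrier_vec n" "A *\<^sub>v x0 \<in> carrier_vec m"
    by (auto intro!: carrier_vecI)
  have "A *\<^sub>v (x0 + mat_inv B *\<^sub>v (A\<^sup>T *\<^sub>v y)) = A *\<^sub>v x0 + A *\<^sub>v (mat_inv B *\<^sub>v (A\<^sup>T *\<^sub>v y))"
    using A x0 by (intro mult_add_distrib_mat_vec) (auto intro!: carrier_vecI)
  also have "A *\<^sub>v (mat_inv B *\<^sub>v (A\<^sup>T *\<^sub>v y)) = (L\<^sup>T * L) *\<^sub>v y"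
    unfolding L_gram using d by (simp add: mult_vec_assoc_dim mult_assoc_dim)
  also have "\<dots> = L\<^sup>T *\<^sub>v (L *\<^sub>v y)" using d by (simp add: mult_vec_assoc_dim)
  finally have 1: "A *\<^sub>v (x0 + mat_inv B *\<^sub>v (A\<^sup>T *\<^sub>v y)) = A *\<^sub>v x0 + L\<^sup>T *\<^sub>v (L *\<^sub>v y)" .
  have 2: "L\<^sup>T *\<^sub>v (L *\<^sub>v (y - ystar)) = L\<^sup>T *\<^sub>v (L *\<^sub>v y) - L\<^sup>T *\<^sub>v (L *\<^sub>v ystar)"
    using mult_minus_distrib_mat_vec[OF L_carrier y ystar]
      mult_minus_distrib_mat_vec[OF transpose_carrier_mat[THEN iffD2, OF L_carrier] c(3,4)] by simp
  show ?thesis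
  proof (rule eq_vecI)
    fix i assume "i < dim_vec (- (L\<^sup>T *\<^sub>v (L *\<^sub>v (y - ystar))))"
    then have i: "i < m" by simp
    have "(L\<^sup>T *\<^sub>v (L *\<^sub>v ystar)) $ i = b $ i - (A *\<^sub>v x0) $ i"
      unfolding stationary using i by simp
    then show "(b - A *\<^sub>v (x0 + mat_inv B *\<^sub>v (A\<^sup>T *\<^sub>v y))) $ i = (- (L\<^sup>T *\<^sub>v (L *\<^sub>v (y - ystar)))) $ i"
      unfolding 1 2 using i c by (simp del: index_mult_mat_vec)
  qed simp
qed

text \<open>This identifies the matrix whose pseudoinverse the algorithm uses as the Gram matrix of \<open>L S\<close>.\<close>

lemma sketch_gram: "dim_row S = m \<Longrightarrow> S\<^sup>T * A * mat_inv B * A\<^sup>T * S = (L * S)\<^sup>T * (L * S)"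
proof -
  assume S: "dim_row S = m"
  have "(L * S)\<^sup>T * (L * S) = S\<^sup>T * (L\<^sup>T * L) * S" using S by (simp add: mat_dims)
  then show ?thesis unfolding L_gram using S by (simp add: mult_assoc_dim)
qed

lemma sketch_pinv_dims [simp]:
  "dim_row S = m \<Longrightarrow> dim_row (sketch_pinv A B S) = dim_col S"
  "dim_row S = m \<Longrightarrow> dim_col (sketch_pinv A B S) = dim_col S"
proof -
  assume S: "dim_row S = m"
  have "L * S \<in> carrier_mat n (dim_col S)" by (rule carrier_matI) simp_all
  from dims_gram(3,4)[OF this]
  show "dim_row (sketch_pinv A B S) = dim_col S" "dim_col (sketch_pinv A B S) = dim_col S"
    unfolding sketch_pinv_def sketch_gram[OF S] .
qed

lemma range_proj_sketch:
  "dim_row S = m \<Longrightarrow> range_proj (L * S) = L * (S * (sketch_pinv A B S * (S\<^sup>T * L\<^sup>T)))"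
proof -
  assume S: "dim_row S = m"
  have "range_proj (L * S) = L * S * sketch_pinv A B S * (L * S)\<^sup>T"
    unfolding range_proj_def sketch_pinv_def sketch_gram[OF S] ..
  then show ?thesis using S by (simp add: mat_dims)
qed

lemma sketch_Z_proj: "dim_row S = m \<Longrightarrow> R * sketch_Z A B S * R = range_proj (L * S)"
proof -
  assume S: "dim_row S = m"
  have "R * sketch_Z A B S * R = (R * A\<^sup>T) * (S * (sketch_pinv A B S * (S\<^sup>T * (A * R))))"
    using S by (simp add: sketch_Z_def sketch_H_def mult_assoc_dim)
  then show ?thesis unfolding range_proj_sketch[OF S] L_transpose by (simp add: L_def)
qed

text \<open>Conversely, the entries of \<open>Z\<close> are linear combinations of those of the projection. This
transfers integrability to \<open>Z\<close>.\<close>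

lemma sketch_Z_of_proj: "dim_row S = m \<Longrightarrow> sketch_Z A B S = (B * R) * range_proj (L * S) * (R * B)"
proof -
  assume S: "dim_row S = m"
  have dZ: "dim_row (sketch_Z A B S) = n" "dim_col (sketch_Z A B S) = n"
    by (simp_all add: sketch_Z_def)
  have "(B * R) * range_proj (L * S) * (R * B) = (B * R * R) * sketch_Z A B S * (R * R * B)"
    unfolding sketch_Z_proj[OF S, symmetric] using dZ by (simp add: mult_assoc_dim)
  also have "\<dots> = sketch_Z A B S"
    unfolding B_R_R using carrier_matI[OF dZ] by simp
  finally show ?thesis ..
qed

lemma msdsa_carrier:
  assumes "y0 \<in> carrier_vec m"
  shows "msdsa A B b x0 \<omega> \<beta> y0 y0 S k \<in> carrier_vec m"
proof -
  have "dim_vec (msdsa A B b x0 \<omega> \<beta> y0 y0 S k) = m"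
    using assms by (induction k rule: induct_nat_012) (auto simp: Let_def)
  then show ?thesis by (rule carrier_vecI)
qed

text \<open>The dual step is \<open>u = S \<lambda>\<close> with \<open>\<lambda> = - G\<^sup>\<dagger> S\<^sup>T L\<^sup>T x\<close> for \<open>x = L (y - y\<^sub>*)\<close>, so \<open>L u = - P x\<close>; the rest of the
recursion is linear.\<close>

lemma msdsa_momentum_iter:
  assumes y0: "y0 \<in> carrier_vec m" and S: "\<And>i. 1 \<le> i \<Longrightarrow> dim_row (S i) = m"
  shows "L *\<^sub>v (msdsa A B b x0 \<omega> \<beta> y0 y0 S k - ystar)
    = momentum_iter \<omega> \<beta> (L *\<^sub>v (y0 - ystar)) (\<lambda>i. range_proj (L * S i)) k"
proof (induction k rule: induct_nat_012)
  case (ge2 k)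
  define y y' where "y = msdsa A B b x0 \<omega> \<beta> y0 y0 S (Suc k)" and "y' = msdsa A B b x0 \<omega> \<beta> y0 y0 S k"
  have y: "y \<in> carrier_vec m" "y' \<in> carrier_vec m" using msdsa_carrier[OF y0] by (auto simp: y_def y'_def)
  define T where "T = S (Suc k)"
  have T: "dim_row T = m" using S by (simp add: T_def)
  define u where "u = T *\<^sub>v dual_lambda A B b x0 T y"
  define x x' where "x = L *\<^sub>v (y - ystar)" and "x' = L *\<^sub>v (y' - ystar)"
  have u: "u \<in> carrier_vec m" using T by (auto simp: u_def intro!: carrier_vecI)
  have dx: "dim_vec x = n" by (simp add: x_def)
  have x: "x \<in> carrier_vec n" "x' \<in> carrier_vec n" by (auto simp: x_def x'_def intro!: carrier_vecI)
  have "L * T \<in> carrier_mat n (dim_col T)" by (rule carrier_matI) simp_all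
  from carrier_matD[OF range_proj_carrier[OF this]]
  have dP: "dim_row (range_proj (L * T)) = n" "dim_col (range_proj (L * T)) = n" .
  have Lu: "L *\<^sub>v u = - (range_proj (L * T) *\<^sub>v x)"
  proof -
    have r: "b - A *\<^sub>v (x0 + mat_inv B *\<^sub>v (A\<^sup>T *\<^sub>v y)) = - (L\<^sup>T *\<^sub>v x)"
      unfolding x_def by (rule dual_residual[OF y(1)])
    define Q where "Q = L * (T * (sketch_pinv A B T * T\<^sup>T))"
    have "L *\<^sub>v u = Q *\<^sub>v (- (L\<^sup>T *\<^sub>v x))"
      unfolding u_def dual_lambda_def r Q_def using T by (simp add: mult_vec_assoc_dim)
    also have "\<dots> = - (Q *\<^sub>v (L\<^sup>T *\<^sub>v x))"
      using T by (intro eq_vecI) (auto simp: Q_def)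
    also have "Q *\<^sub>v (L\<^sup>T *\<^sub>v x) = range_proj (L * T) *\<^sub>v x"
      unfolding range_proj_sketch[OF T] Q_def using T dx by (simp add: mult_vec_assoc_dim)
    finally show ?thesis .
  qed
  have e: "msdsa A B b x0 \<omega> \<beta> y0 y0 S (Suc (Suc k)) - ystar
      = (y - ystar) + (\<omega> \<cdot>\<^sub>v u + \<beta> \<cdot>\<^sub>v ((y - ystar) - (y' - ystar)))"
    using y u ystar by (intro eq_vecI) (auto simp: Let_def y_def[symmetric] y'_def[symmetric] u_def[symmetric] T_def[symmetric])
  have yy: "y - ystar \<in> carrier_vec m" "y' - ystar \<in> carrier_vec m" using y ystar by auto
  have "L *\<^sub>v ((y - ystar) + (\<omega> \<cdot>\<^sub>v u + \<beta> \<cdot>\<^sub>v ((y - ystar) - (y' - ystar))))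
      = x + (\<omega> \<cdot>\<^sub>v (L *\<^sub>v u) + \<beta> \<cdot>\<^sub>v (x - x'))"
    using yy u L_carrier
    by (simp add: mult_add_distrib_mat_vec[OF L_carrier] mult_mat_vec[OF L_carrier]
        mult_minus_distrib_mat_vec[OF L_carrier] x_def x'_def)
  also have "\<dots> = x - \<omega> \<cdot>\<^sub>v (range_proj (L * T) *\<^sub>v x) + \<beta> \<cdot>\<^sub>v (x - x')"
    unfolding Lu using carrier_vecD[OF x(1)] carrier_vecD[OF x(2)] dP by (intro eq_vecI) simp_all
  finally show ?case
    unfolding e using ge2 by (simp add: Let_def x_def x'_def y_def y'_def T_def)
qed simp_all

end

section \<open>Exactness and the range of the dual map\<close>

context dual_optimum
begin

text \<open>Around a solution, in the coordinates \<open>x = x\<^sub>s + R z\<close>, the stochastic objective is half the quadratic form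
of the projection. Since these coordinates reach all of the space, its minimizers
correspond to the zeros of the form of \<open>W\<close>.\<close>

lemma sketch_f_shift:
  assumes xs: "xs \<in> solution_set A b" and z: "z \<in> carrier_vec n" and S: "dim_row S = m"
  shows "sketch_f A B b S (xs + R *\<^sub>v z) = 1 / 2 * (z \<bullet> (range_proj (L * S) *\<^sub>v z))"
proof -
  have xs': "xs \<in> carrier_vec n" "A *\<^sub>v xs = b" using xs by (auto simp: solution_set_def)
  have d: "dim_vec z = n" "dim_vec (R *\<^sub>v z) = n" using z by auto
  have Rz: "R *\<^sub>v z \<in> carrier_vec n" using d by (intro carrier_vecI)
  have "A *\<^sub>v (xs + R *\<^sub>v z) = b + A *\<^sub>v (R *\<^sub>v z)"
    using mult_add_distrib_mat_vec[OF A xs'(1) Rz] xs' by simp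
  then have res: "A *\<^sub>v (xs + R *\<^sub>v z) - b = L\<^sup>T *\<^sub>v z"
    unfolding L_transpose using d b by (intro eq_vecI) (simp_all add: mult_vec_assoc_dim del: index_mult_mat_vec)
  define H where "H = sketch_H A B S"
  have dH: "dim_row H = m" "dim_col H = m" using S by (simp_all add: H_def sketch_H_def)
  have "(L\<^sup>T *\<^sub>v z) \<bullet> (H *\<^sub>v (L\<^sup>T *\<^sub>v z)) = z \<bullet> (L *\<^sub>v (H *\<^sub>v (L\<^sup>T *\<^sub>v z)))"
    using scalar_prod_mult_vec[of L z "H *\<^sub>v (L\<^sup>T *\<^sub>v z)"] d dH by simp
  also have "L *\<^sub>v (H *\<^sub>v (L\<^sup>T *\<^sub>v z)) = (L * (H * L\<^sup>T)) *\<^sub>v z"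
    using d dH by (simp add: mult_vec_assoc_dim)
  also have "L * (H * L\<^sup>T) = range_proj (L * S)"
    unfolding range_proj_sketch[OF S] H_def sketch_H_def using S by (simp add: mult_assoc_dim)
  finally show ?thesis unfolding sketch_f_def res H_def by simp
qed

lemma solution_shift_surj:
  assumes xs: "xs \<in> carrier_vec n" and x: "x \<in> carrier_vec n"
  obtains z where "z \<in> carrier_vec n" "x = xs + R *\<^sub>v z"
proof -
  have d: "dim_vec xs = n" "dim_vec x = n" using xs x by auto
  have xm: "x - xs \<in> carrier_vec n" using xs x by simp
  have "R *\<^sub>v (R *\<^sub>v (B *\<^sub>v (x - xs))) = (R * R * B) *\<^sub>v (x - xs)"
    using d by (simp add: mult_vec_assoc_dim)
  also have "\<dots> = x - xs" unfolding B_R_R using xm by simp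
  finally have "xs + R *\<^sub>v (R *\<^sub>v (B *\<^sub>v (x - xs))) = x" using d by (intro eq_vecI) simp_all
  then show ?thesis by (intro that[of "R *\<^sub>v (B *\<^sub>v (x - xs))"]) (auto intro!: carrier_vecI)
qed

end

theorem theorem6:
  fixes m n :: nat
    and A B :: "real mat" and b x0 y0 y1 ystar :: "real vec"
    and \<D> :: "real mat measure"
    and M :: "'w measure" and S :: "nat \<Rightarrow> 'w \<Rightarrow> real mat"
    and y :: "nat \<Rightarrow> 'w \<Rightarrow> real vec"
    and \<omega> \<beta> lmin lmax a1 a2 q \<delta> :: real
  assumes A: "A \<in> carrier_mat m n" and b: "b \<in> carrier_vec m"
    and consistent: "solution_set A b \<noteq> {}"
    and B: "spd_mat n B"
    and x0: "x0 \<in> carrier_vec n"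
    and distribution: "prob_space \<D>" "sets \<D> = sets (sketch_space m)"
    and W_nonzero: "W_mat \<D> A B \<noteq> 0\<^sub>m n n"
    and exact: "exactness \<D> A B b"
    and prob_space: "prob_space M"
    and indep: "prob_space.indep_vars M (\<lambda>_. sketch_space m) S {1..}"
    and distr: "\<And>k. 1 \<le> k \<Longrightarrow> distr M (sketch_space m) (S k) = \<D>"
    and y0: "y0 \<in> carrier_vec m" and y0_eq_y1: "y0 = y1"
    and y: "\<And>k w. y k w = msdsa A B b x0 \<omega> \<beta> y0 y1 (\<lambda>i. S i w) k"
    and \<omega>: "0 \<le> \<omega>" "\<omega> \<le> 2" and \<beta>: "0 \<le> \<beta>"
    and lmin: "lmin = lambda_min_pos (W_mat \<D> A B)"
    and lmax: "lmax = lambda_max (W_mat \<D> A B)"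
    and a1: "a1 = 1 + 3 * \<beta> + 2 * \<beta>\<^sup>2 - (\<omega> * (2 - \<omega>) + \<omega> * \<beta>) * lmin"
    and a2: "a2 = \<beta> + 2 * \<beta>\<^sup>2 + \<omega> * \<beta> * lmax"
    and a1_a2: "a1 + a2 < 1"
    and ystar: "ystar \<in> carrier_vec m"
      "\<And>z. z \<in> carrier_vec m \<Longrightarrow> dual_obj A B b x0 z \<le> dual_obj A B b x0 ystar"
    and q: "q = (a1 + sqrt (a1\<^sup>2 + 4 * a2)) / 2"
    and \<delta>: "\<delta> = q - a1"
  shows "(\<forall>k. integrable M (\<lambda>w. dual_obj A B b x0 ystar - dual_obj A B b x0 (y (k + 1) w)) \<and>
              (\<integral>w. (dual_obj A B b x0 ystar - dual_obj A B b x0 (y (k + 1) w)) \<partial>M)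
                \<le> q ^ k * (1 + \<delta>) * (dual_obj A B b x0 ystar - dual_obj A B b x0 y0)) \<and>
         a1 + a2 \<le> q \<and> q < 1"
proof -
  interpret dual: dual_optimum A B b x0 m n ystar
    by unfold_locales (fact A B b x0 ystar)+
  define L where "L = dual.L"
  define R where "R = dual.R"
  note L_carrier = dual.L_carrier[folded L_def]
  have LS: "L * T \<in> carrier_mat n (dim_col T)" for T :: "real mat"
    using carrier_matD[OF L_carrier] by (intro carrier_matI) simp_all
  define v where "v = L *\<^sub>v (y0 - ystar)"
  have v: "v \<in> carrier_vec n" using carrier_matD[OF L_carrier] by (intro carrier_vecI) (simp add: v_def)
  interpret random_projections M "sketch_space m" \<D> S "\<lambda>T. range_proj (L * T)" n v \<omega> \<beta>
  proof -
    interpret prob_space M by (fact prob_space)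
    show "random_projections M (sketch_space m) \<D> S (\<lambda>T. range_proj (L * T)) n v \<omega> \<beta>"
    proof unfold_locales
      show "indep_vars (\<lambda>_. sketch_space m) S {1..}" by (fact indep)
      show "distr M (sketch_space m) (S k) = \<D>" if "1 \<le> k" for k by (fact distr[OF that])
      show "orth_projection n (range_proj (L * T))" for T
        using range_proj_carrier[OF LS] range_proj_transpose[OF LS] range_proj_idem[OF LS]
        by (simp add: orth_projection_def)
      show "(\<lambda>T. range_proj (L * T) $$ (i, j)) \<in> borel_measurable (sketch_space m)" if "i < n" "j < n" for i j
        by (rule borel_measurable_sketch_proj[OF L_carrier that])
      show "\<bar>range_proj (L * T) $$ (i, j)\<bar> \<le> 1" if "i < n" "j < n" for T i j
        by (rule range_proj_entry_bound[OF LS that])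
    qed (fact v \<omega> \<beta>)+
  qed
  have spaceD: "space \<D> = {T. dim_row T = m}" by (simp add: space_D space_sketch_space)
  have Rc: "R \<in> carrier_mat n n" using dual.R_carrier by (simp add: R_def)
  have W: "W_mat \<D> A B = mean_proj"
  proof -
    have BR: "B * R \<in> carrier_mat n n" "R * B \<in> carrier_mat n n"
      using carrier_matD[OF Rc] dual.dims by (auto intro!: carrier_matI)
    have Z: "sketch_Z A B T \<in> carrier_mat n n" if "T \<in> space \<D>" for T
      by (intro carrier_matI) (simp_all add: sketch_Z_def)
    have Z_int: "integrable \<D> (\<lambda>T. sketch_Z A B T $$ (i, j))" if "i < n" "j < n" for i j
    proof -
      have "integrable \<D> (\<lambda>T. ((B * R) * range_proj (L * T) * (R * B)) $$ (i, j))"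
        by (rule expectation_mult_mat3(1)[OF BR range_proj_carrier[OF LS] D_entry_integrable that])
      moreover have "sketch_Z A B T = (B * R) * range_proj (L * T) * (R * B)" if "T \<in> space \<D>" for T
        using dual.sketch_Z_of_proj[of T] that by (simp add: spaceD L_def R_def)
      ultimately show ?thesis
        by (subst Bochner_Integration.integrable_cong[OF refl]) auto
    qed
    have EZ: "expected_Z \<D> A B = Matrix.mat n n (\<lambda>(i, j). \<integral>T. sketch_Z A B T $$ (i, j) \<partial>\<D>)"
      by (simp add: expected_Z_def)
    have Wdef: "W_mat \<D> A B = R * expected_Z \<D> A B * R"
      by (simp add: W_mat_def R_def dual.R_def)
    show ?thesis
    proof (rule eq_matI)
      fix i j assume "i < dim_row mean_proj" "j < dim_col mean_proj"
      then have ij: "i < n" "j < n" by (auto simp: mean_proj_def)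
      have "W_mat \<D> A B $$ (i, j) = (\<integral>T. (R * sketch_Z A B T * R) $$ (i, j) \<partial>\<D>)"
        unfolding Wdef EZ by (rule expectation_mult_mat3(2)[OF Rc Rc Z Z_int ij, symmetric])
      also have "\<dots> = (\<integral>T. range_proj (L * T) $$ (i, j) \<partial>\<D>)"
        using dual.sketch_Z_proj by (intro Bochner_Integration.integral_cong refl) (simp add: spaceD L_def R_def)
      finally show "W_mat \<D> A B $$ (i, j) = mean_proj $$ (i, j)" using ij by (simp add: mean_proj_def)
    qed (use carrier_matD[OF Rc] in \<open>simp_all add: Wdef mean_proj_def\<close>)
  qed
  \<comment> \<open>Exactness: moving from a solution along a kernel vector of \<open>W\<close> keeps the objective at its minimum 0, hence leads to another solution.\<close>
  have kernel: "L\<^sup>T *\<^sub>v z = 0\<^sub>v m" if z: "z \<in> carrier_vec n" and Wz: "mean_proj *\<^sub>v z = 0\<^sub>v n" for z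
  proof -
    obtain xs where xs: "xs \<in> solution_set A b" using consistent by blast
    then have xs': "xs \<in> carrier_vec n" "A *\<^sub>v xs = b" by (auto simp: solution_set_def)
    have f: "stoch_f \<D> A B b (xs + R *\<^sub>v u) = 1 / 2 * (u \<bullet> (mean_proj *\<^sub>v u))" if u: "u \<in> carrier_vec n" for u
    proof -
      have "stoch_f \<D> A B b (xs + R *\<^sub>v u) = (\<integral>T. 1 / 2 * (u \<bullet> (range_proj (L * T) *\<^sub>v u)) \<partial>\<D>)"
        unfolding stoch_f_def
        using dual.sketch_f_shift[OF xs u] by (intro Bochner_Integration.integral_cong refl) (simp add: spaceD L_def R_def)
      then show ?thesis by (simp add: mean_proj_quadratic_form[OF u])
    qed
    have Rz: "R *\<^sub>v z \<in> carrier_vec n" using Rc z by simp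
    have "xs + R *\<^sub>v z \<in> minimizers n (stoch_f \<D> A B b)"
      unfolding minimizers_def
    proof (intro CollectI conjI ballI)
      fix x :: "real vec" assume "x \<in> carrier_vec n"
      then obtain u where u: "u \<in> carrier_vec n" "x = xs + R *\<^sub>v u"
        using dual.solution_shift_surj[OF xs'(1)] unfolding R_def by blast
      show "stoch_f \<D> A B b (xs + R *\<^sub>v z) \<le> stoch_f \<D> A B b x"
        unfolding u(2) f[OF z] f[OF u(1)] Wz using z mean_proj_nonneg[OF u(1)] by simp
    qed (use xs' Rz in simp)
    then have "A *\<^sub>v (xs + R *\<^sub>v z) = b"
      using exact A by (auto simp: exactness_def solution_set_def)
    then have "b + A *\<^sub>v (R *\<^sub>v z) = b" using mult_add_distrib_mat_vec[OF A xs'(1) Rz] xs' by simp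
    moreover have "A *\<^sub>v (R *\<^sub>v z) \<in> carrier_vec m" using A Rz by simp
    moreover have "L\<^sup>T *\<^sub>v z = A *\<^sub>v (R *\<^sub>v z)"
      using A Rc z by (simp add: L_def R_def dual.L_transpose mult_vec_assoc_dim)
    ultimately show ?thesis using b by (simp add: vec_eq_iff del: index_mult_mat_vec)
  qed
  have iter_y: "iter k w = L *\<^sub>v (y k w - ystar)" if "w \<in> space M" for k w
  proof -
    have "dim_row (S i w) = m" if "1 \<le> i" for i
      using X_space[OF that \<open>w \<in> space M\<close>] by (simp add: space_sketch_space)
    then have "L *\<^sub>v (y k w - ystar) = momentum_iter \<omega> \<beta> v (\<lambda>i. range_proj (L * S i w)) k"
      unfolding v_def L_def y y0_eq_y1[symmetric] by (rule dual.msdsa_momentum_iter[OF y0])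
    then show ?thesis by (simp add: iter_def)
  qed
  have y_carrier: "y k w \<in> carrier_vec m" for k w
    unfolding y y0_eq_y1[symmetric] by (rule dual.msdsa_carrier[OF y0])
  have gap: "dual_obj A B b x0 ystar - dual_obj A B b x0 (y k w) = 1 / 2 * (iter k w \<bullet> iter k w)"
    if "w \<in> space M" for k w
    unfolding iter_y[OF that] by (rule dual.dual_gap[OF y_carrier, folded L_def])
  \<comment> \<open>The iterates lie in the range of \<open>L\<close>, which is orthogonal to the kernel of \<open>W\<close>.\<close>
  have lower: "lmin * (iter k w \<bullet> iter k w) \<le> iter k w \<bullet> (mean_proj *\<^sub>v iter k w)" if w: "w \<in> space M" for k w
    unfolding lmin W
  proof (rule rayleigh_ge_lambda_min_pos[OF mean_proj_carrier mean_proj_transpose iter_carrier])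
    fix z assume z: "z \<in> carrier_vec n" and Wz: "mean_proj *\<^sub>v z = 0\<^sub>v n"
    have u: "y k w - ystar \<in> carrier_vec m" using y_carrier ystar by simp
    have "z \<bullet> (L *\<^sub>v (y k w - ystar)) = (L\<^sup>T *\<^sub>v z) \<bullet> (y k w - ystar)"
      using carrier_matD[OF L_carrier] carrier_vecD[OF z] carrier_vecD[OF u] by (intro scalar_prod_mult_vec) simp_all
    then show "z \<bullet> iter k w = 0" unfolding iter_y[OF w] kernel[OF z Wz] using u by simp
  qed
  have upper: "x \<bullet> (mean_proj *\<^sub>v x) \<le> lmax * (x \<bullet> x)" if "x \<in> carrier_vec n" for x
    unfolding lmax W by (rule rayleigh_le_lambda_max[OF mean_proj_carrier mean_proj_transpose that])
  \<comment> \<open>An empty matrix would be zero.\<close>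
  have "0 < n"
  proof (rule ccontr)
    assume "\<not> 0 < n"
    then have "mean_proj = 0\<^sub>m n n"
      using carrier_matD[OF mean_proj_carrier] by (intro eq_matI) simp_all
    then show False using W_nonzero W by simp
  qed
  then have "0 \<le> lmax" unfolding lmax W by (rule mean_proj_lambda_max_nonneg)
  then have a2_nonneg: "0 \<le> a2" using \<omega> \<beta> by (simp add: a2)
  note rate = two_term_recursion_rate[OF a2_nonneg a1_a2 q]
  define F where "F k = expectation (\<lambda>w. iter k w \<bullet> iter k w)" for k
  have F0: "F 0 = v \<bullet> v" "F 1 = F 0" by (simp_all add: F_def iter_def prob_space)
  have bound: "F (k + 1) \<le> q ^ k * (1 + (q - a1)) * F 0" for k
  proof (rule two_term_recursion_bound[OF _ F0(2) _ rate(1-3)])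
    show "0 \<le> F k" for k
      unfolding F_def by (rule Bochner_Integration.integral_nonneg_AE[OF AE_I2]) (rule scalar_prod_self_nonneg)
    show "F (k + 2) \<le> a1 * F (k + 1) + a2 * F k" for k
      unfolding F_def a1 a2 by (rule expected_norm_recursion[OF lower upper])
  qed
  have gap0: "dual_obj A B b x0 ystar - dual_obj A B b x0 y0 = 1 / 2 * F 0"
    unfolding F0 v_def L_def by (rule dual.dual_gap[OF y0])
  have gap_F: "(\<integral>w. (dual_obj A B b x0 ystar - dual_obj A B b x0 (y k w)) \<partial>M) = 1 / 2 * F k" for k
  proof -
    have "(\<integral>w. (dual_obj A B b x0 ystar - dual_obj A B b x0 (y k w)) \<partial>M) = (\<integral>w. 1 / 2 * (iter k w \<bullet> iter k w) \<partial>M)"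
      by (rule Bochner_Integration.integral_cong[OF refl gap])
    then show ?thesis by (simp add: F_def)
  qed
  have "integrable M (\<lambda>w. dual_obj A B b x0 ystar - dual_obj A B b x0 (y k w))" for k
    by (rule Bochner_Integration.integrable_cong[THEN iffD2, OF refl gap]) (simp_all add: iter_norm_integrable)
  moreover have "(\<integral>w. (dual_obj A B b x0 ystar - dual_obj A B b x0 (y (k + 1) w)) \<partial>M)
      \<le> q ^ k * (1 + \<delta>) * (dual_obj A B b x0 ystar - dual_obj A B b x0 y0)" for k
    unfolding gap_F gap0 \<delta> using bound[of k] by simp
  ultimately show ?thesis using rate(4,5) by blast
qed

end
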